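(* There exists a universal $\mathrm{\Pi}_1$-formula $U(x)$ which is optimal: for every universal $\mathrm{\Pi}_1$-formula $U'(x)$ there is a constant $c$ such that for every closed $\mathrm{\Pi}_1$-statement $T$, the $U$-complexity of $T$ is at most the $U'$-complexity of $T$ plus $c$.
   Context: $\mathsf{PA}$ is Peano arithmetic; strings are identified with natural numbers. A $\mathrm{\Pi}_1$-formula $U(x)$ with one free variable is universal if for every closed $\mathrm{\Pi}_1$-statement $T$ there is a string $t$ with $\mathsf{PA}\vdash [T\Leftrightarrow U(t)]$. For universal $U$, the $U$-complexity of a closed $\mathrm{\Pi}_1$-statement $T$ is the minimal length of a string $t$ with $\mathsf{PA}\vdash [T\Leftrightarrow U(t)]$. *)

theory Defs
  imports Main
begin

section \<open>First-order arithmetic\<close>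

text \<open>
  The language is $0, S, +, \cdot, =, <$ with de Bruijn indices. Falsum, implication and the
  universal quantifier are primitive; logic is classical.
\<close>

datatype tm = Var nat | Zero | Succ tm | Plus tm tm | Times tm tm

datatype fm = Bot | Eq tm tm | Less tm tm | Imp fm fm | All fm

abbreviation Neg :: "fm \<Rightarrow> fm" where "Neg p \<equiv> Imp p Bot"
abbreviation Or :: "fm \<Rightarrow> fm \<Rightarrow> fm" where "Or p q \<equiv> Imp (Neg p) q"
abbreviation And :: "fm \<Rightarrow> fm \<Rightarrow> fm" where "And p q \<equiv> Neg (Imp p (Neg q))"
abbreviation Iff :: "fm \<Rightarrow> fm \<Rightarrow> fm" where "Iff p q \<equiv> And (Imp p q) (Imp q p)"

primrec numeral_tm :: "nat \<Rightarrow> tm" where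
  "numeral_tm 0 = Zero"
| "numeral_tm (Suc n) = Succ (numeral_tm n)"

primrec fv_tm :: "tm \<Rightarrow> nat set" where
  "fv_tm (Var n) = {n}"
| "fv_tm Zero = {}"
| "fv_tm (Succ t) = fv_tm t"
| "fv_tm (Plus s t) = fv_tm s \<union> fv_tm t"
| "fv_tm (Times s t) = fv_tm s \<union> fv_tm t"

primrec fv :: "fm \<Rightarrow> nat set" where
  "fv Bot = {}"
| "fv (Eq s t) = fv_tm s \<union> fv_tm t"
| "fv (Less s t) = fv_tm s \<union> fv_tm t"
| "fv (Imp p q) = fv p \<union> fv q"
| "fv (All p) = {n. Suc n \<in> fv p}"

primrec subst_tm :: "(nat \<Rightarrow> tm) \<Rightarrow> tm \<Rightarrow> tm" where
  "subst_tm \<sigma> (Var n) = \<sigma> n"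
| "subst_tm \<sigma> Zero = Zero"
| "subst_tm \<sigma> (Succ t) = Succ (subst_tm \<sigma> t)"
| "subst_tm \<sigma> (Plus s t) = Plus (subst_tm \<sigma> s) (subst_tm \<sigma> t)"
| "subst_tm \<sigma> (Times s t) = Times (subst_tm \<sigma> s) (subst_tm \<sigma> t)"

abbreviation lift_tm :: "tm \<Rightarrow> tm" where
  "lift_tm \<equiv> subst_tm (\<lambda>n. Var (Suc n))"

primrec subst :: "(nat \<Rightarrow> tm) \<Rightarrow> fm \<Rightarrow> fm" where
  "subst \<sigma> Bot = Bot"
| "subst \<sigma> (Eq s t) = Eq (subst_tm \<sigma> s) (subst_tm \<sigma> t)"
| "subst \<sigma> (Less s t) = Less (subst_tm \<sigma> s) (subst_tm \<sigma> t)"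
| "subst \<sigma> (Imp p q) = Imp (subst \<sigma> p) (subst \<sigma> q)"
| "subst \<sigma> (All p) = All (subst (case_nat (Var 0) (\<lambda>n. lift_tm (\<sigma> n))) p)"

abbreviation lift :: "fm \<Rightarrow> fm" where
  "lift \<equiv> subst (\<lambda>n. Var (Suc n))"

text \<open>
  \<open>inst p t\<close> replaces variable 0 by \<open>t\<close> and lowers all other indices: it is the instance at \<open>t\<close>
  of the quantified formula \<open>All p\<close>.
\<close>

abbreviation inst :: "fm \<Rightarrow> tm \<Rightarrow> fm" where
  "inst p t \<equiv> subst (case_nat t Var) p"


section \<open>Derivability and Peano arithmetic\<close>

text \<open>
  A Hilbert calculus for classical first-order logic with equality. Because of the rule \<open>gen\<close>,
  an axiom with free variables has the force of its universal closure.
\<close>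

inductive derives :: "fm set \<Rightarrow> fm \<Rightarrow> bool" (infix "\<turnstile>" 50) for A :: "fm set" where
  ax: "p \<in> A \<Longrightarrow> A \<turnstile> p"
| imp_k: "A \<turnstile> Imp p (Imp q p)"
| imp_s: "A \<turnstile> Imp (Imp p (Imp q r)) (Imp (Imp p q) (Imp p r))"
| dneg: "A \<turnstile> Imp (Neg (Neg p)) p"
| all_inst: "A \<turnstile> Imp (All p) (inst p t)"
| all_imp: "A \<turnstile> Imp (All (Imp p q)) (Imp (All p) (All q))"
| all_vacuous: "A \<turnstile> Imp p (All (lift p))"
| eq_refl: "A \<turnstile> Eq t t"
| eq_leibniz: "A \<turnstile> Imp (Eq s t) (Imp (inst p s) (inst p t))"
| mp: "A \<turnstile> Imp p q \<Longrightarrow> A \<turnstile> p \<Longrightarrow> A \<turnstile> q"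
| gen: "A \<turnstile> p \<Longrightarrow> A \<turnstile> All p"

text \<open>
  In \<open>induction\<close> the formula \<open>p\<close> may contain parameters (variables other than 0); the substitution
  there sends variable 0 to its successor and fixes every other variable.
\<close>

inductive_set PA :: "fm set" where
  succ_nonzero: "Neg (Eq (Succ (Var 0)) Zero) \<in> PA"
| succ_inj: "Imp (Eq (Succ (Var 0)) (Succ (Var 1))) (Eq (Var 0) (Var 1)) \<in> PA"
| plus_zero: "Eq (Plus (Var 0) Zero) (Var 0) \<in> PA"
| plus_succ: "Eq (Plus (Var 0) (Succ (Var 1))) (Succ (Plus (Var 0) (Var 1))) \<in> PA"
| times_zero: "Eq (Times (Var 0) Zero) Zero \<in> PA"
| times_succ: "Eq (Times (Var 0) (Succ (Var 1))) (Plus (Times (Var 0) (Var 1)) (Var 0)) \<in> PA"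
| less_zero: "Neg (Less (Var 0) Zero) \<in> PA"
| less_succ: "Iff (Less (Var 0) (Succ (Var 1)))
                  (Or (Less (Var 0) (Var 1)) (Eq (Var 0) (Var 1))) \<in> PA"
| induction: "Imp (inst p Zero)
             (Imp (All (Imp p (subst (case_nat (Succ (Var 0)) (\<lambda>n. Var (Suc n))) p)))
               (All p)) \<in> PA"


section \<open>The class \<open>\<Pi>\<^sub>1\<close>\<close>

text \<open>
  Lifting the bound \<open>t\<close> expresses that the quantified variable does not occur in it. The bounded
  existential quantifier is the dual \<open>Neg (All (Imp (Less (Var 0) (lift_tm t)) (Neg p)))\<close>.
\<close>

inductive Delta0 :: "fm \<Rightarrow> bool" where
  "Delta0 Bot"
| "Delta0 (Eq s t)"
| "Delta0 (Less s t)"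
| "Delta0 p \<Longrightarrow> Delta0 q \<Longrightarrow> Delta0 (Imp p q)"
| "Delta0 p \<Longrightarrow> Delta0 (All (Imp (Less (Var 0) (lift_tm t)) p))"

text \<open>A possibly empty block of universal quantifiers in front of a bounded formula.\<close>

inductive Pi1 :: "fm \<Rightarrow> bool" where
  "Delta0 p \<Longrightarrow> Pi1 p"
| "Pi1 p \<Longrightarrow> Pi1 (All p)"

definition Pi1_sentence :: "fm \<Rightarrow> bool" where
  "Pi1_sentence T \<longleftrightarrow> Pi1 T \<and> fv T = {}"


section \<open>Strings, universal formulas and complexity\<close>

text \<open>
  Binary strings are identified with natural numbers in length-lexicographic order: the binary
  expansion of \<open>string_nat s + 1\<close> is the digit 1 followed by \<open>s\<close>.
\<close>

definition string_nat :: "bool list \<Rightarrow> nat" where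
  "string_nat s = foldl (\<lambda>n b. 2 * n + (if b then 2 else 1)) 0 s"

lemma string_nat_snoc:
  "string_nat (s @ [b]) = 2 * string_nat s + (if b then 2 else 1)"
  by (simp add: string_nat_def)

lemma bij_string_nat: "bij string_nat"
proof (rule bijI)
  have "string_nat s = string_nat t \<Longrightarrow> s = t" for s t
  proof (induction s arbitrary: t rule: rev_induct)
    case Nil
    then show ?case
      by (cases t rule: rev_cases) (auto simp: string_nat_snoc string_nat_def split: if_splits)
  next
    case (snoc b s)
    show ?case
    proof (cases t rule: rev_cases)
      case Nil
      with snoc.prems show ?thesis
        by (auto simp: string_nat_snoc string_nat_def split: if_splits)
    next
      case (snoc t' b')
      with snoc.prems have "2 * string_nat s + (if b then 2 else 1)
          = 2 * string_nat t' + (if b' then 2 else 1)"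
        by (simp add: string_nat_snoc)
      then have "b = b' \<and> string_nat s = string_nat t'"
        by (cases b; cases b'; simp; presburger)
      with snoc snoc.IH show ?thesis by simp
    qed
  qed
  then show "inj string_nat" by (rule injI)
next
  have "\<exists>s. string_nat s = n" for n
  proof (induction n rule: less_induct)
    case (less n)
    show ?case
    proof (cases "n = 0")
      case True
      then show ?thesis by (auto intro!: exI[of _ "[]"] simp: string_nat_def)
    next
      case False
      then have "(n - 1) div 2 < n" by linarith
      then obtain s where "string_nat s = (n - 1) div 2" using less by blast
      then have "string_nat (s @ [even n]) = n" using False
        by (cases "even n") (simp_all add: string_nat_snoc, presburger+)
      then show ?thesis by blast
    qed
  qed
  then show "surj string_nat" by (metis surj_def)
qed

abbreviation at_string :: "fm \<Rightarrow> bool list \<Rightarrow> fm" where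
  "at_string U t \<equiv> inst U (numeral_tm (string_nat t))"

definition universal :: "fm \<Rightarrow> bool" where
  "universal U \<longleftrightarrow> Pi1 U \<and> fv U = {0} \<and>
     (\<forall>T. Pi1_sentence T \<longrightarrow> (\<exists>t. PA \<turnstile> Iff T (at_string U t)))"

definition complexity :: "fm \<Rightarrow> fm \<Rightarrow> nat" where
  "complexity U T = (LEAST n. \<exists>t. length t = n \<and> PA \<turnstile> Iff T (at_string U t))"

end

theory Submission
  imports Defs "HOL-Library.Countable_Set"
begin

text \<open>
  The falsity of a \<open>\<Pi>\<^sub>1\<close> formula has a finite certificate: a set of facts ``relation \<open>r\<close> holds in
  environment \<open>e\<close>'' in which every fact follows from others in one step. Syntax and environments are
  nested pairs, and a finite set is a triple \<open>(c, d, n)\<close> coding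
  \<open>{i. i < n \<and> 1 + (i + 1) d dvd c}\<close>, so being a certificate is \<open>\<Delta>\<^sub>0\<close>. The optimal formula says
  that no certificate contains the fact denoted by its argument. A decoding step, itself part of the
  certificates, reads the string \<open>t @ False # replicate k True\<close> as ``program \<open>k\<close> on input \<open>t\<close>'', so
  a universal \<open>U'\<close> with program \<open>k\<close> is simulated at a cost of \<open>k + 1\<close> symbols. Provable equivalence in
  PA is reduced to equivalence in all (also nonstandard) models by Henkin's completeness theorem; the
  formula and its program are standard, so induction over them takes place outside the model.
\<close>

section \<open>Substitution\<close>

text \<open>Relations are kept positive, with negation pushed to the atoms, because a certificate
  only asserts facts: justification is then monotone, and certificates are closed under union and
  can be assembled from those of subrelations. The obstacle is the nonstandard model, where a
  certificate is an element of the model: a set of facts gets a code by being bounded and definable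
  there. This is why each fixed relation is shown to be definable, and why existence of certificates
  costs beta coding and collection, while soundness holds for arbitrary sets. Decoding by
  certificate steps replaces a bounded definition of string length or of powers of two; halving is
  all that it uses. The unary code for the program is wasteful, but its length depends on the
  simulated formula alone.\<close>

lemma subst_tm_comp: "subst_tm \<sigma> (subst_tm \<tau> t) = subst_tm (\<lambda>n. subst_tm \<sigma> (\<tau> n)) t"
  by (induction t) auto

lemma subst_tm_Var [simp]: "subst_tm Var t = t"
  by (induction t) auto

lemma subst_tm_cong: "(\<And>n. n \<in> fv_tm t \<Longrightarrow> \<sigma> n = \<tau> n) \<Longrightarrow> subst_tm \<sigma> t = subst_tm \<tau> t"
  by (induction t) auto

lemma subst_comp: "subst \<sigma> (subst \<tau> p) = subst (\<lambda>n. subst_tm \<sigma> (\<tau> n)) p"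
proof (induction p arbitrary: \<sigma> \<tau>)
  case (All p)
  have "(\<lambda>n. subst_tm (case_nat (Var 0) (\<lambda>n. lift_tm (\<sigma> n))) (case_nat (Var 0) (\<lambda>n. lift_tm (\<tau> n)) n))
      = case_nat (Var 0) (\<lambda>n. lift_tm (subst_tm \<sigma> (\<tau> n)))"
    by (auto simp: fun_eq_iff subst_tm_comp split: nat.split)
  then show ?case by (simp add: All.IH)
qed (simp_all add: subst_tm_comp)

lemma subst_cong: "(\<And>n. n \<in> fv p \<Longrightarrow> \<sigma> n = \<tau> n) \<Longrightarrow> subst \<sigma> p = subst \<tau> p"
proof (induction p arbitrary: \<sigma> \<tau>)
  case (All p)
  show ?case using All.prems by (auto intro!: All.IH split: nat.split)
next
  case (Imp p q)
  have "subst \<sigma> p = subst \<tau> p" "subst \<sigma> q = subst \<tau> q"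
    using Imp.prems by (auto intro: Imp.IH)
  then show ?case by simp
qed (auto intro: subst_tm_cong)

lemma case_nat_Var: "case_nat (Var 0) (\<lambda>n. Var (Suc n)) = Var"
  by (auto simp: fun_eq_iff split: nat.split)

lemma subst_Var [simp]: "subst Var p = p"
  by (induction p) (simp_all add: case_nat_Var)

lemma subst_inst: "inst (subst (case_nat (Var 0) (\<lambda>n. lift_tm (\<sigma> n))) p) t = subst (case_nat t \<sigma>) p"
proof -
  have "(\<lambda>n. subst_tm (case_nat t Var) (case_nat (Var 0) (\<lambda>n. lift_tm (\<sigma> n)) n)) = case_nat t \<sigma>"
    by (auto simp: fun_eq_iff subst_tm_comp split: nat.split)
  then show ?thesis by (simp add: subst_comp)
qed

lemma finite_fv_tm: "finite (fv_tm t)"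
  by (induction t) auto

lemma finite_fv: "finite (fv p)"
proof (induction p)
  case (All p)
  have "{n. Suc n \<in> fv p} = Suc -` fv p" by auto
  then show ?case using All by (simp add: finite_vimageI)
qed (simp_all add: finite_fv_tm)

text \<open>The calculus has no substitution rule, so a simultaneous substitution is built from
  single instantiations. The induction treats \<open>All p\<close> with the shifted terms and fills
  variable 0 last; \<open>subst_inst\<close> merges the two.\<close>

lemma derives_All_pow:
  "A \<turnstile> (All ^^ k) p \<Longrightarrow> A \<turnstile> subst (\<lambda>n. if n < k then \<sigma> n else Var (n - k)) p"
proof (induction k arbitrary: p \<sigma>)
  case 0
  then show ?case by simp
next
  case (Suc k)
  let ?\<tau> = "\<lambda>n. if n < k then \<sigma> (Suc n) else Var (n - k)"
  have "A \<turnstile> (All ^^ k) (All p)" using Suc.prems by (simp add: funpow_swap1)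
  then have "A \<turnstile> All (subst (case_nat (Var 0) (\<lambda>n. lift_tm (?\<tau> n))) p)"
    using Suc.IH[of "All p" "\<lambda>n. \<sigma> (Suc n)"] by (simp only: subst.simps)
  note inst = derives.mp[OF all_inst this, of "\<sigma> 0", unfolded subst_inst]
  have "case_nat (\<sigma> 0) ?\<tau> = (\<lambda>n. if n < Suc k then \<sigma> n else Var (n - Suc k))"
    by (auto simp: fun_eq_iff split: nat.split)
  with inst show ?case by (simp only:)
qed

lemma derives_subst:
  assumes "A \<turnstile> p"
  shows "A \<turnstile> subst \<sigma> p"
proof -
  obtain k where k: "\<And>n. n \<in> fv p \<Longrightarrow> n < k"
    using finite_fv[of p] unfolding finite_nat_set_iff_bounded by blast
  have "A \<turnstile> (All ^^ k) p"
    by (induction k) (simp_all add: assms gen)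
  then have "A \<turnstile> subst (\<lambda>n. if n < k then \<sigma> n else Var (n - k)) p"
    by (rule derives_All_pow)
  moreover have "subst (\<lambda>n. if n < k then \<sigma> n else Var (n - k)) p = subst \<sigma> p"
    by (rule subst_cong) (simp add: k)
  ultimately show ?thesis by simp
qed


section \<open>Henkin completeness\<close>

text \<open>
  Unlike axioms, the hypotheses in \<open>H\<close> are not closed under \<open>gen\<close>: their free variables act as
  constants.
\<close>

inductive entails :: "fm set \<Rightarrow> fm set \<Rightarrow> fm \<Rightarrow> bool" for A H where
  derived: "A \<turnstile> p \<Longrightarrow> entails A H p"
| hyp: "p \<in> H \<Longrightarrow> entails A H p"
| mp: "entails A H (Imp p q) \<Longrightarrow> entails A H p \<Longrightarrow> entails A H q"

lemma derives_id: "A \<turnstile> Imp p p"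
  by (rule derives.mp[OF derives.mp[OF imp_s imp_k] imp_k[of A p p]])

lemma entails_imp_k: "entails A H p \<Longrightarrow> entails A H (Imp q p)"
  by (rule entails.mp[OF entails.derived[OF imp_k]])

text \<open>Modus ponens is the only rule that acts on hypotheses; \<open>gen\<close> is confined to
  \<open>derived\<close>, so it is never applied to a formula that depends on
  \<open>q\<close>.\<close>

lemma deduction: "entails A (insert q H) p \<Longrightarrow> entails A H (Imp q p)"
proof (induction rule: entails.induct)
  case (hyp p)
  then show ?case
    using entails.derived[OF derives_id] entails_imp_k[OF entails.hyp] by (cases "p = q") auto
next
  case (mp p r)
  show ?case by (rule entails.mp[OF entails.mp[OF entails.derived[OF imp_s] mp.IH(1)] mp.IH(2)])
qed (auto intro: entails_imp_k entails.derived)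

lemma entails_mono: "entails A H p \<Longrightarrow> H \<subseteq> H' \<Longrightarrow> entails A H' p"
proof (induction rule: entails.induct)
  case (mp p q)
  show ?case by (rule entails.mp[OF mp.IH(1)[OF mp.prems] mp.IH(2)[OF mp.prems]])
qed (auto intro: entails.derived entails.hyp)

lemma entails_empty: "entails A {} p \<Longrightarrow> A \<turnstile> p"
proof (induction rule: entails.induct)
  case (mp p q)
  show ?case by (rule derives.mp[OF mp.IH])
qed simp_all

lemma entails_subst: "entails A H p \<Longrightarrow> entails A (subst \<sigma> ` H) (subst \<sigma> p)"
proof (induction rule: entails.induct)
  case (mp p q)
  show ?case by (rule entails.mp[OF mp.IH(1)[unfolded subst.simps(4)] mp.IH(2)])
qed (auto intro: entails.derived entails.hyp derives_subst)

text \<open>A lifted hypothesis does not mention variable 0, and \<open>all_vacuous\<close> restores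
  it under the new quantifier.\<close>

lemma entails_lift_gen: "entails A (lift ` H) p \<Longrightarrow> entails A H (All p)"
proof (induction rule: entails.induct)
  case (derived p)
  then show ?case by (auto intro: entails.derived gen)
next
  case (hyp p)
  then obtain q where q: "q \<in> H" "p = lift q" by blast
  show ?case unfolding q(2) by (rule entails.mp[OF entails.derived[OF all_vacuous] entails.hyp[OF q(1)]])
next
  case (mp p q)
  show ?case by (rule entails.mp[OF entails.mp[OF entails.derived[OF all_imp] mp.IH(1)] mp.IH(2)])
qed

lemma entails_gen_fresh:
  assumes ent: "entails A H (inst p (Var v))"
    and fresh: "v \<notin> fv (All p)" "\<And>q. q \<in> H \<Longrightarrow> v \<notin> fv q"
  shows "entails A H (All p)"
proof -
  \<comment> \<open>This renaming turns the named variable \<open>v\<close> into de Bruijn index 0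
    and, on formulas without \<open>v\<close>, is \<open>lift\<close>.\<close>
  define \<sigma> where "\<sigma> = (\<lambda>n. if n = v then Var 0 else Var (Suc n))"
  have "subst \<sigma> (inst p (Var v)) = subst Var p"
    unfolding subst_comp using fresh(1)
    by (intro subst_cong) (auto simp: \<sigma>_def split: nat.split)
  moreover have "subst \<sigma> ` H = lift ` H"
    using fresh(2) by (intro image_cong refl subst_cong) (auto simp: \<sigma>_def)
  ultimately show ?thesis
    using entails_subst[OF ent, of \<sigma>] by (auto intro: entails_lift_gen)
qed

instance tm :: countable by countable_datatype
instance fm :: countable by countable_datatype

definition fresh_var :: "fm set \<Rightarrow> nat" where
  "fresh_var H = (SOME v. \<forall>q\<in>H. v \<notin> fv q)"

text \<open>Variables serve as the Henkin constants; the stages stay finite, so a fresh one always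
  remains. When \<open>q\<close> is refuted, \<open>Neg q\<close> is already entailed; a refuted
  \<open>All p\<close> also receives a counterexample.\<close>

definition henkin_step :: "fm set \<Rightarrow> fm \<Rightarrow> fm set \<Rightarrow> fm set" where
  "henkin_step A q H =
    (if entails A (insert q H) Bot
     then (case q of All p \<Rightarrow> insert (Neg (inst p (Var (fresh_var (insert q H))))) H | _ \<Rightarrow> H)
     else insert q H)"

primrec henkin :: "fm set \<Rightarrow> fm set \<Rightarrow> nat \<Rightarrow> fm set" where
  "henkin A H 0 = H"
| "henkin A H (Suc n) = henkin_step A (from_nat n) (henkin A H n)"

lemma fresh_var:
  assumes "finite H" "q \<in> H"
  shows "fresh_var H \<notin> fv q"
proof -
  have "finite (\<Union>q\<in>H. fv q)" using assms finite_fv by auto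
  then obtain v where "v \<notin> (\<Union>q\<in>H. fv q)" by (meson ex_new_if_finite infinite_UNIV_nat)
  then have "\<exists>v. \<forall>q\<in>H. v \<notin> fv q" by blast
  then have "\<forall>q\<in>H. fresh_var H \<notin> fv q" unfolding fresh_var_def by (rule someI_ex)
  with assms(2) show ?thesis by blast
qed

lemma henkin_step_mono: "H \<subseteq> henkin_step A q H"
  by (auto simp: henkin_step_def split: fm.splits)

lemma henkin_step_finite: "finite H \<Longrightarrow> finite (henkin_step A q H)"
  by (auto simp: henkin_step_def split: fm.splits)

lemma henkin_step_consistent:
  assumes "finite H" "\<not> entails A H Bot"
  shows "\<not> entails A (henkin_step A q H) Bot"
proof (cases "entails A (insert q H) Bot \<and> (\<exists>p. q = All p)")
  case True
  then obtain p where q: "q = All p" and "entails A H (Neg (All p))"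
    by (auto dest: deduction)
  define v where "v = fresh_var (insert q H)"
  have "\<not> entails A (insert (Neg (inst p (Var v))) H) Bot"
  proof
    assume "entails A (insert (Neg (inst p (Var v))) H) Bot"
    then have "entails A H (Neg (Neg (inst p (Var v))))" by (rule deduction)
    then have "entails A H (inst p (Var v))" by (rule entails.mp[OF entails.derived[OF dneg]])
    then have "entails A H (All p)"
    proof (rule entails_gen_fresh)
      show "v \<notin> fv (All p)" using fresh_var[of "insert q H" q] assms q by (simp add: v_def)
      show "v \<notin> fv r" if "r \<in> H" for r
        using fresh_var[of "insert q H" r] assms that by (simp add: v_def)
    qed
    with \<open>entails A H (Neg (All p))\<close> assms show False using entails.mp[of A H "All p" Bot] by simp
  qed
  with True q show ?thesis by (simp add: henkin_step_def v_def)
next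
  case False
  with assms show ?thesis by (auto simp: henkin_step_def split: fm.splits)
qed

lemma henkin_consistent:
  assumes "finite H" "\<not> entails A H Bot"
  shows "finite (henkin A H n) \<and> \<not> entails A (henkin A H n) Bot"
  by (induction n) (use assms in \<open>auto simp: henkin_step_consistent henkin_step_finite\<close>)

lemma henkin_mono: "m \<le> n \<Longrightarrow> henkin A H m \<subseteq> henkin A H n"
  by (rule lift_Suc_mono_le) (auto simp: henkin_step_mono subsetD)

lemma entails_henkin_UN:
  "entails A (\<Union>n. henkin A H n) p \<Longrightarrow> \<exists>n. entails A (henkin A H n) p"
proof (induction rule: entails.induct)
  case (mp p q)
  then obtain m n where "entails A (henkin A H m) (Imp p q)" "entails A (henkin A H n) p" by blast
  then have "entails A (henkin A H (max m n)) (Imp p q)" "entails A (henkin A H (max m n)) p"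
    by (auto elim!: entails_mono intro!: henkin_mono)
  then show ?case using entails.mp[of A "henkin A H (max m n)" p q] by auto
qed (auto intro: entails.derived entails.hyp)

lemma henkin_extension:
  assumes "finite H" "\<not> entails A H Bot"
  obtains D where "H \<subseteq> D" "\<And>p. entails A D p \<Longrightarrow> p \<in> D" "Bot \<notin> D"
    "\<And>p. p \<in> D \<or> Neg p \<in> D" "\<And>p. (\<And>t. inst p t \<in> D) \<Longrightarrow> All p \<in> D"
proof
  let ?U = "\<Union>n. henkin A H n"
  let ?D = "{p. entails A ?U p}"
  have U: "henkin A H n \<subseteq> ?U" for n by auto
  have *: "entails A ?U p" if "entails A ?D p" for p
    using that
  proof (induction rule: entails.induct)
    case (mp p q)
    show ?case by (rule entails.mp[OF mp.IH])
  qed (auto intro: entails.derived)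
  show "H \<subseteq> ?D" using U[of 0] by (auto intro: entails.hyp)
  show "\<And>p. entails A ?D p \<Longrightarrow> p \<in> ?D" using * by auto
  show bot: "Bot \<notin> ?D" using entails_henkin_UN henkin_consistent[OF assms] by blast
  \<comment> \<open>Every formula \<open>p\<close> is treated at stage
    \<open>to_nat p\<close>.\<close>
  have step: "p \<in> henkin A H (Suc (to_nat p)) \<or> entails A (insert p (henkin A H (to_nat p))) Bot" for p
    by (auto simp: henkin_step_def)
  have inD: "p \<in> ?D" if "p \<in> henkin A H n" for p n
    using that U by (auto intro: entails.hyp)
  show "p \<in> ?D \<or> Neg p \<in> ?D" for p
  proof (cases "p \<in> henkin A H (Suc (to_nat p))")
    case False
    then have "entails A (henkin A H (to_nat p)) (Neg p)" using step[of p] by (simp add: deduction)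
    then show ?thesis using U entails_mono by blast
  qed (use inD in blast)
  show "All p \<in> ?D" if inst: "\<And>t. inst p t \<in> ?D" for p
  proof (rule ccontr)
    assume "All p \<notin> ?D"
    then have "All p \<notin> henkin A H (Suc (to_nat (All p)))" using inD by blast
    then have "\<exists>v. Neg (inst p (Var v)) \<in> henkin A H (Suc (to_nat (All p)))"
      by (auto simp: henkin_step_def split: if_splits)
    then obtain v where "Neg (inst p (Var v)) \<in> ?D" using inD by blast
    then have "entails A ?U (Neg (inst p (Var v)))" by simp
    moreover have "entails A ?U (inst p (Var v))" using inst by blast
    ultimately have "entails A ?U Bot" by (rule entails.mp)
    with bot show False by simp
  qed
qed

section \<open>Structures, models and the completeness theorem\<close>

locale arith_structure =
  fixes zero :: 'a ("\<zero>")
    and succ :: "'a \<Rightarrow> 'a"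
    and plus :: "'a \<Rightarrow> 'a \<Rightarrow> 'a" (infixl "\<oplus>" 65)
    and times :: "'a \<Rightarrow> 'a \<Rightarrow> 'a" (infixl "\<otimes>" 70)
    and less :: "'a \<Rightarrow> 'a \<Rightarrow> bool" (infix "\<prec>" 50)
begin

primrec eval :: "(nat \<Rightarrow> 'a) \<Rightarrow> tm \<Rightarrow> 'a" where
  "eval e (Var n) = e n"
| "eval e Zero = \<zero>"
| "eval e (Succ t) = succ (eval e t)"
| "eval e (Plus s t) = eval e s \<oplus> eval e t"
| "eval e (Times s t) = eval e s \<otimes> eval e t"

primrec sat :: "(nat \<Rightarrow> 'a) \<Rightarrow> fm \<Rightarrow> bool" where
  "sat e Bot \<longleftrightarrow> False"
| "sat e (Eq s t) \<longleftrightarrow> eval e s = eval e t"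
| "sat e (Less s t) \<longleftrightarrow> eval e s \<prec> eval e t"
| "sat e (Imp p q) \<longleftrightarrow> (sat e p \<longrightarrow> sat e q)"
| "sat e (All p) \<longleftrightarrow> (\<forall>x. sat (case_nat x e) p)"

lemma eval_subst: "eval e (subst_tm \<sigma> t) = eval (\<lambda>n. eval e (\<sigma> n)) t"
  by (induction t) auto

lemma sat_subst: "sat e (subst \<sigma> p) \<longleftrightarrow> sat (\<lambda>n. eval e (\<sigma> n)) p"
proof (induction p arbitrary: e \<sigma>)
  case (All p)
  have "(\<lambda>n. eval (case_nat x e) (case_nat (Var 0) (\<lambda>n. lift_tm (\<sigma> n)) n))
      = case_nat x (\<lambda>n. eval e (\<sigma> n))" for x
    by (auto simp: fun_eq_iff eval_subst split: nat.split)
  then show ?case by (simp add: All.IH)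
qed (simp_all add: eval_subst)

end

text \<open>Models satisfy all theorems, not just the axioms: the term model delivers this, and a
  given derivation of an equivalence is used in this form. Countability lets the odd variables of
  \<open>param_env\<close> name every element.\<close>

locale PA_model = arith_structure zero succ plus times less
  for zero :: "'a :: countable" ("\<zero>")
    and succ :: "'a \<Rightarrow> 'a"
    and plus :: "'a \<Rightarrow> 'a \<Rightarrow> 'a" (infixl "\<oplus>" 65)
    and times :: "'a \<Rightarrow> 'a \<Rightarrow> 'a" (infixl "\<otimes>" 70)
    and less :: "'a \<Rightarrow> 'a \<Rightarrow> bool" (infix "\<prec>" 50) +
  assumes sat_theorem: "PA \<turnstile> p \<Longrightarrow> sat e p"

lemma entails_Eq_numeral_tm:
  assumes "entails PA D (Eq (numeral_tm m) (numeral_tm n))" "\<not> entails PA D Bot"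
  shows "m = n"
  using assms(1)
proof (induction m arbitrary: n)
  have nz: "entails PA D (Neg (Eq (Succ t) Zero))" for t
    using derives_subst[OF ax[OF succ_nonzero], of "\<lambda>_. t"] by (auto intro: entails.derived)
  {
    case 0
    have "entails PA D (Eq t Zero)" if "entails PA D (Eq Zero t)" for t
    proof -
      have "PA \<turnstile> Imp (Eq Zero t) (Imp (Eq Zero Zero) (Eq t Zero))"
        using eq_leibniz[of PA Zero t "Eq (Var 0) Zero"] by simp
      from entails.mp[OF entails.mp[OF entails.derived[OF this] that] entails.derived[OF eq_refl]]
      show ?thesis .
    qed
    with 0 nz show ?case using assms(2) entails.mp[OF nz] by (cases n) auto
  next
    case (Suc m)
    show ?case
    proof (cases n)
      case 0
      with Suc.prems assms(2) show ?thesis using entails.mp[OF nz] by auto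
    next
      case (Suc k)
      have "PA \<turnstile> Imp (Eq (Succ s) (Succ t)) (Eq s t)" for s t
        using derives_subst[OF ax[OF succ_inj], of "case_nat s (\<lambda>_. t)"] by simp
      from entails.mp[OF entails.derived[OF this], of D "numeral_tm m" "numeral_tm k"] Suc.prems Suc
      have "entails PA D (Eq (numeral_tm m) (numeral_tm k))" by simp
      with Suc.IH Suc show ?thesis by simp
    qed
  }
qed


text \<open>The models range over \<open>nat\<close> because the assumption cannot quantify over
  types. The terms modulo the equalities in a Henkin set form a countably infinite quotient, as
  distinct numerals stay distinct, and its elements are renamed by numbers.\<close>

theorem PA_completeness:
  assumes valid: "\<And>(z::nat) s a m l e. PA_model z s a m l \<Longrightarrow> arith_structure.sat z s a m l e p"
  shows "PA \<turnstile> p"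
proof (rule ccontr)
  assume not_derivable: "\<not> PA \<turnstile> p"
  have "\<not> entails PA {Neg p} Bot"
  proof
    assume "entails PA {Neg p} Bot"
    then have "entails PA {} (Neg (Neg p))" by (rule deduction)
    then have "PA \<turnstile> Neg (Neg p)" by (rule entails_empty)
    then have "PA \<turnstile> p" by (rule derives.mp[OF dneg])
    with not_derivable show False by contradiction
  qed
  then obtain D where D: "{Neg p} \<subseteq> D" "\<And>p. entails PA D p \<Longrightarrow> p \<in> D" "Bot \<notin> D"
    "\<And>p. p \<in> D \<or> Neg p \<in> D" "\<And>p. (\<And>t. inst p t \<in> D) \<Longrightarrow> All p \<in> D"
    by (rule henkin_extension[rotated]) auto
  have D_derived: "q \<in> D" if "PA \<turnstile> q" for q
    by (rule D(2)[OF entails.derived[OF that]])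
  have D_mp: "r \<in> D" if "Imp q r \<in> D" "q \<in> D" for q r
    by (rule D(2)[OF entails.mp[OF entails.hyp[OF that(1)] entails.hyp[OF that(2)]]])
  have D_Imp: "Imp q r \<in> D \<longleftrightarrow> (q \<in> D \<longrightarrow> r \<in> D)" for q r
  proof
    assume "q \<in> D \<longrightarrow> r \<in> D"
    then consider "r \<in> D" | "Neg q \<in> D" using D(4) by blast
    then show "Imp q r \<in> D"
    proof cases
      case 1
      then show ?thesis using D_mp[OF D_derived[OF imp_k]] by blast
    next
      case 2
      then have "entails PA (insert q D) Bot"
        by (intro entails.mp[of PA _ q Bot] entails.hyp) auto
      then have "entails PA (insert q D) r"
        by (rule entails.mp[OF entails.derived[OF dneg] entails_imp_k])
      then show ?thesis by (intro D(2) deduction)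
    qed
  qed (blast intro: D_mp)
  have D_All: "All q \<in> D \<longleftrightarrow> (\<forall>t. inst q t \<in> D)" for q
    using D(5) D_mp[OF D_derived[OF all_inst]] by blast
  have leibniz: "inst q s \<in> D \<Longrightarrow> inst q t \<in> D" if "Eq s t \<in> D" for q s t
    by (rule D_mp[OF D_mp[OF D_derived[OF eq_leibniz] that]])

  define R where "R = {(s, t). Eq s t \<in> D}"
  have refl: "Eq t t \<in> D" for t by (rule D_derived[OF eq_refl])
  have sym: "Eq t s \<in> D" if "Eq s t \<in> D" for s t
    using leibniz[OF that, of "Eq (Var 0) (lift_tm s)"] refl by (simp add: subst_tm_comp)
  have trans: "Eq s u \<in> D" if "Eq s t \<in> D" "Eq t u \<in> D" for s t u
    using leibniz[OF that(2), of "Eq (lift_tm s) (Var 0)"] that(1) by (simp add: subst_tm_comp)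
  have equiv: "equiv UNIV R"
    by (rule equivI) (auto simp: R_def refl_on_def sym_def trans_def intro: refl sym trans)
  have "inj (\<lambda>n. R `` {numeral_tm n})"
  proof (rule injI)
    fix m n assume "R `` {numeral_tm m} = R `` {numeral_tm n}"
    then have "Eq (numeral_tm m) (numeral_tm n) \<in> D" using refl by (auto simp: R_def)
    then show "m = n" by (rule entails_Eq_numeral_tm[OF entails.hyp]) (use D(2,3) in blast)
  qed
  then have "infinite (range (\<lambda>n. R `` {numeral_tm n}))" by (simp add: finite_image_iff)
  then have "infinite (UNIV // R)"
    by (rule infinite_super[rotated]) (auto simp: quotient_def)
  moreover have "countable (UNIV // R)" by (simp add: quotient_def)
  ultimately obtain g :: "tm set \<Rightarrow> nat" where g: "bij_betw g (UNIV // R) UNIV"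
    by (meson countableE_infinite)
  define h where "h t = g (R `` {t})" for t
  have h_eq: "h s = h t \<longleftrightarrow> Eq s t \<in> D" for s t
  proof -
    have "h s = h t \<longleftrightarrow> R `` {s} = R `` {t}"
      using g unfolding h_def by (auto simp: bij_betw_def inj_on_eq_iff quotientI)
    also have "\<dots> \<longleftrightarrow> (s, t) \<in> R" using equiv by (simp add: eq_equiv_class_iff)
    also have "\<dots> \<longleftrightarrow> Eq s t \<in> D" by (simp add: R_def)
    finally show ?thesis .
  qed
  have "\<exists>t. h t = x" for x
  proof -
    have "x \<in> g ` (UNIV // R)" using g by (simp add: bij_betw_def)
    then show ?thesis by (auto simp: quotient_def h_def)
  qed
  then obtain r where h_r [simp]: "\<And>x. h (r x) = x" by metis
  have r_h: "Eq (r (h t)) t \<in> D" for t by (simp flip: h_eq)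

  define s where "s x = h (Succ (r x))" for x
  define a where "a x y = h (Plus (r x) (r y))" for x y
  define m where "m x y = h (Times (r x) (r y))" for x y
  define l where "l x y \<longleftrightarrow> Less (r x) (r y) \<in> D" for x y
  interpret M: arith_structure "h Zero" s a m l .
  have s_h: "s (h t) = h (Succ t)" for t
    using leibniz[OF r_h[of t], of "Eq (Succ (lift_tm (r (h t)))) (Succ (Var 0))"] refl
    by (simp add: s_def h_eq subst_tm_comp)
  have cong2: "h (F (r (h t)) (r (h u))) = h (F t u)"
    if F: "\<And>\<sigma> t u. subst_tm \<sigma> (F t u) = F (subst_tm \<sigma> t) (subst_tm \<sigma> u)" for F t u
  proof -
    have "Eq (F (r (h t)) (r (h u))) (F t (r (h u))) \<in> D"
      using leibniz[OF r_h[of t], of "Eq (lift_tm (F (r (h t)) (r (h u)))) (F (Var 0) (lift_tm (r (h u))))"] refl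
      by (simp add: subst_tm_comp F)
    moreover have "Eq (F t (r (h u))) (F t u) \<in> D"
      using leibniz[OF r_h[of u], of "Eq (lift_tm (F t (r (h u)))) (F (lift_tm t) (Var 0))"] refl
      by (simp add: subst_tm_comp F)
    ultimately show ?thesis unfolding h_eq by (rule trans)
  qed
  have a_h: "a (h t) (h u) = h (Plus t u)" for t u unfolding a_def by (rule cong2) simp
  have m_h: "m (h t) (h u) = h (Times t u)" for t u unfolding m_def by (rule cong2) simp
  have l_h: "l (h t) (h u) \<longleftrightarrow> Less t u \<in> D" for t u
  proof -
    have *: "Less t v \<in> D \<Longrightarrow> Less t' v \<in> D" if "Eq t t' \<in> D" for t t' v
      using leibniz[OF that, of "Less (Var 0) (lift_tm v)"] by (simp add: subst_tm_comp)
    have "Less v t \<in> D \<Longrightarrow> Less v t' \<in> D" if "Eq t t' \<in> D" for t t' v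
      using leibniz[OF that, of "Less (lift_tm v) (Var 0)"] by (simp add: subst_tm_comp)
    with * show ?thesis unfolding l_def using r_h sym by metis
  qed
  have eval: "M.eval (\<lambda>n. h (\<sigma> n)) t = h (subst_tm \<sigma> t)" for \<sigma> t
    by (induction t) (simp_all add: s_h a_h m_h)
  \<comment> \<open>In this truth lemma an assignment is presented by a substitution, so that the
    quantifier case becomes an instance of \<open>D_All\<close>.\<close>
  have sat: "M.sat (\<lambda>n. h (\<sigma> n)) q \<longleftrightarrow> subst \<sigma> q \<in> D" for \<sigma> q
  proof (induction q arbitrary: \<sigma>)
    case (All q)
    have "M.sat (\<lambda>n. h (\<sigma> n)) (All q) \<longleftrightarrow> (\<forall>t. M.sat (case_nat (h t) (\<lambda>n. h (\<sigma> n))) q)"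
      by (metis M.sat.simps(5) h_r)
    also have "\<dots> \<longleftrightarrow> (\<forall>t. M.sat (\<lambda>n. h (case_nat t \<sigma> n)) q)"
    proof -
      have "case_nat (h t) (\<lambda>n. h (\<sigma> n)) = (\<lambda>n. h (case_nat t \<sigma> n))" for t
        by (auto simp: fun_eq_iff split: nat.split)
      then show ?thesis by simp
    qed
    also have "\<dots> \<longleftrightarrow> (\<forall>t. subst (case_nat t \<sigma>) q \<in> D)" by (simp add: All.IH)
    also have "\<dots> \<longleftrightarrow> subst \<sigma> (All q) \<in> D" by (simp add: D_All subst_inst)
    finally show ?case .
  qed (simp_all add: D(3) D_Imp eval h_eq l_h)
  interpret M: PA_model "h Zero" s a m l
  proof
    fix q e assume "PA \<turnstile> q"
    then have "subst (\<lambda>n. r (e n)) q \<in> D" by (intro D_derived derives_subst)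
    then show "M.sat e q" by (simp flip: sat)
  qed
  have "M.sat (\<lambda>n. h (Var n)) p" by (rule valid) (rule M.PA_model_axioms)
  then have "p \<in> D" by (simp add: sat)
  with D(1,3) D_mp show False by blast
qed

section \<open>Arithmetic in a model\<close>

context PA_model
begin

lemma sat_axiom: "p \<in> PA \<Longrightarrow> sat e p"
  by (rule sat_theorem[OF ax])

abbreviation env2 :: "'a \<Rightarrow> 'a \<Rightarrow> nat \<Rightarrow> 'a" where
  "env2 x y \<equiv> case_nat x (\<lambda>_. y)"

lemma succ_neq_zero [simp]: "succ x \<noteq> \<zero>" "\<zero> \<noteq> succ x"
  using sat_axiom[OF PA.succ_nonzero, of "env2 x x"] by auto

lemma succ_inject [simp]: "succ x = succ y \<longleftrightarrow> x = y"
  using sat_axiom[OF PA.succ_inj, of "env2 x y"] by auto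

lemma plus_zero_right [simp]: "x \<oplus> \<zero> = x"
  using sat_axiom[OF PA.plus_zero, of "env2 x x"] by simp

lemma plus_succ_right [simp]: "x \<oplus> succ y = succ (x \<oplus> y)"
  using sat_axiom[OF PA.plus_succ, of "env2 x y"] by simp

lemma times_zero_right [simp]: "x \<otimes> \<zero> = \<zero>"
  using sat_axiom[OF PA.times_zero, of "env2 x x"] by simp

lemma times_succ_right [simp]: "x \<otimes> succ y = x \<otimes> y \<oplus> x"
  using sat_axiom[OF PA.times_succ, of "env2 x y"] by simp

lemma not_less_zero [simp]: "\<not> x \<prec> \<zero>"
  using sat_axiom[OF PA.less_zero, of "env2 x x"] by simp

lemma less_succ_iff: "x \<prec> succ y \<longleftrightarrow> x \<prec> y \<or> x = y"
  using sat_axiom[OF PA.less_succ, of "env2 x y"] by auto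

text \<open>
  A formula is evaluated with the variables of the predicate at even indices and with an
  enumeration of the whole (countable) model at odd indices, so that every element may be used
  as a parameter.
\<close>

definition param_env :: "(nat \<Rightarrow> 'a) \<Rightarrow> nat \<Rightarrow> 'a" where
  "param_env e n = (if even n then e (n div 2) else from_nat (n div 2))"

definition definable :: "((nat \<Rightarrow> 'a) \<Rightarrow> bool) \<Rightarrow> bool" where
  "definable P \<longleftrightarrow> (\<exists>p. \<forall>e. P e \<longleftrightarrow> sat (param_env e) p)"

definition definable_fun :: "((nat \<Rightarrow> 'a) \<Rightarrow> 'a) \<Rightarrow> bool" where
  "definable_fun f \<longleftrightarrow> (\<exists>t. \<forall>e. f e = eval (param_env e) t)"

lemma definable_fun_var: "definable_fun (\<lambda>e. e n)"
  unfolding definable_fun_def by (rule exI[of _ "Var (2 * n)"]) (simp add: param_env_def)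

lemma definable_fun_const: "definable_fun (\<lambda>e. c)"
  unfolding definable_fun_def
  by (rule exI[of _ "Var (Suc (2 * to_nat c))"]) (simp add: param_env_def)

lemma definable_fun_succ: "definable_fun f \<Longrightarrow> definable_fun (\<lambda>e. succ (f e))"
  unfolding definable_fun_def by (metis eval.simps(3))

lemma definable_fun_plus:
  "definable_fun f \<Longrightarrow> definable_fun g \<Longrightarrow> definable_fun (\<lambda>e. f e \<oplus> g e)"
  unfolding definable_fun_def by (metis eval.simps(4))

lemma definable_fun_times:
  "definable_fun f \<Longrightarrow> definable_fun g \<Longrightarrow> definable_fun (\<lambda>e. f e \<otimes> g e)"
  unfolding definable_fun_def by (metis eval.simps(5))

lemma definable_eq: "definable_fun f \<Longrightarrow> definable_fun g \<Longrightarrow> definable (\<lambda>e. f e = g e)"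
  unfolding definable_fun_def definable_def by (metis sat.simps(2))

lemma definable_less: "definable_fun f \<Longrightarrow> definable_fun g \<Longrightarrow> definable (\<lambda>e. f e \<prec> g e)"
  unfolding definable_fun_def definable_def by (metis sat.simps(3))

lemma definable_False: "definable (\<lambda>e. False)"
  unfolding definable_def by (metis sat.simps(1))

lemma definable_imp: "definable P \<Longrightarrow> definable Q \<Longrightarrow> definable (\<lambda>e. P e \<longrightarrow> Q e)"
  unfolding definable_def by (metis sat.simps(4))

lemma definable_not: "definable P \<Longrightarrow> definable (\<lambda>e. \<not> P e)"
  using definable_imp[OF _ definable_False, of P] by simp

lemma definable_conj: "definable P \<Longrightarrow> definable Q \<Longrightarrow> definable (\<lambda>e. P e \<and> Q e)"
  using definable_not[OF definable_imp[OF _ definable_not, of P Q]] by simp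

lemma definable_disj: "definable P \<Longrightarrow> definable Q \<Longrightarrow> definable (\<lambda>e. P e \<or> Q e)"
  using definable_imp[OF definable_not, of P Q] by (simp add: disj_imp)

lemma definable_iff: "definable P \<Longrightarrow> definable Q \<Longrightarrow> definable (\<lambda>e. P e \<longleftrightarrow> Q e)"
  using definable_conj[OF definable_imp definable_imp, of P Q Q P] by (simp add: iff_conv_conj_imp)

lemma definable_subst:
  assumes "definable P" "\<And>n. definable_fun (\<lambda>e. f e n)"
  shows "definable (\<lambda>e. P (f e))"
proof -
  from assms(1) obtain p where p: "\<And>e. P e \<longleftrightarrow> sat (param_env e) p" by (auto simp: definable_def)
  from assms(2) obtain t where t: "\<And>n e. f e n = eval (param_env e) (t n)"
    unfolding definable_fun_def by metis
  define \<sigma> where "\<sigma> n = (if even n then t (n div 2) else Var n)" for n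
  have "(\<lambda>n. eval (param_env e) (\<sigma> n)) = param_env (f e)" for e
    by (auto simp: \<sigma>_def t fun_eq_iff) (auto simp: param_env_def t)
  then have "P (f e) \<longleftrightarrow> sat (param_env e) (subst \<sigma> p)" for e
    by (simp add: p sat_subst)
  then show ?thesis unfolding definable_def by blast
qed

lemma definable_all:
  assumes "definable (\<lambda>e. P (e 0) (\<lambda>n. e (Suc n)))"
  shows "definable (\<lambda>e. \<forall>x. P x e)"
proof -
  from assms obtain p where p: "\<And>e. P (e 0) (\<lambda>n. e (Suc n)) \<longleftrightarrow> sat (param_env e) p"
    by (auto simp: definable_def)
  \<comment> \<open>The binder raises every index by 1, while the new first argument raises the even
    ones by 2: hence \<open>n - 1\<close> for even and \<open>Suc n\<close> for odd indices.\<close>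
  define \<sigma> where "\<sigma> n = (if n = 0 then Var 0 else if even n then Var (n - 1) else Var (Suc n))" for n
  have "(\<lambda>n. eval (case_nat x (param_env e)) (\<sigma> n)) = param_env (case_nat x e)" for x e
  proof
    fix n
    show "eval (case_nat x (param_env e)) (\<sigma> n) = param_env (case_nat x e) n"
    proof (cases "even n")
      case True
      then obtain k where "n = 2 * k" by blast
      then show ?thesis by (cases k) (auto simp: \<sigma>_def param_env_def)
    next
      case False
      then show ?thesis by (cases n) (auto simp: \<sigma>_def param_env_def)
    qed
  qed
  then have "P x e \<longleftrightarrow> sat (case_nat x (param_env e)) (subst \<sigma> p)" for x e
    using p[of "case_nat x e"] by (simp add: sat_subst)
  then have "(\<forall>x. P x e) \<longleftrightarrow> sat (param_env e) (All (subst \<sigma> p))" for e by simp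
  then show ?thesis unfolding definable_def by blast
qed

lemma definable_ex:
  assumes "definable (\<lambda>e. P (e 0) (\<lambda>n. e (Suc n)))"
  shows "definable (\<lambda>e. \<exists>x. P x e)"
  using definable_not[OF definable_all[of "\<lambda>x e. \<not> P x e"]] definable_not[OF assms] by simp

lemmas definable_intros = definable_fun_var definable_fun_const definable_fun_succ
  definable_fun_plus definable_fun_times definable_eq definable_less definable_False
  definable_imp definable_not definable_conj definable_disj definable_iff definable_all definable_ex

text \<open>Nonstandard elements are not reached from zero by \<open>succ\<close>, so induction is
  limited to definable predicates, and each use below has a definability goal. In the proof all even
  variables collapse to the induction variable and the odd ones become parameters of the
  schema.\<close>

lemma induct [case_names definable zero succ]:
  assumes "definable (\<lambda>e. P (e 0))" "P \<zero>" "\<And>x. P x \<Longrightarrow> P (succ x)"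
  shows "P x"
proof -
  from assms(1) obtain p where p: "\<And>e. P (e 0) \<longleftrightarrow> sat (param_env e) p"
    by (auto simp: definable_def)
  define \<sigma> where "\<sigma> n = (if even n then Var 0 else Var (Suc n))" for n :: nat
  define e where "e n = param_env (\<lambda>_. \<zero>) n" for n
  define q where "q = subst \<sigma> p"
  have q: "sat (case_nat x e) q \<longleftrightarrow> P x" for x
  proof -
    have "(\<lambda>n. eval (case_nat x e) (\<sigma> n)) = param_env (\<lambda>_. x)"
      by (auto simp: \<sigma>_def e_def param_env_def)
    then show ?thesis by (simp add: q_def sat_subst flip: p)
  qed
  have "(\<lambda>n. eval e (case_nat Zero Var n)) = case_nat \<zero> e"
    "(\<lambda>n. eval (case_nat x e) (case_nat (Succ (Var 0)) (\<lambda>n. Var (Suc n)) n)) = case_nat (succ x) e" for x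
    by (auto simp: fun_eq_iff split: nat.split)
  with sat_axiom[OF PA.induction, of e q] assms(2,3) show ?thesis by (simp add: sat_subst q)
qed

section \<open>Ordered semiring laws in the model\<close>

lemma zero_plus [simp]: "\<zero> \<oplus> x = x"
  by (induct x rule: induct) (auto intro!: definable_intros)

lemma succ_plus [simp]: "succ x \<oplus> y = succ (x \<oplus> y)"
  by (induct y rule: induct) (auto intro!: definable_intros)

lemma plus_commute: "x \<oplus> y = y \<oplus> x"
  by (induct y rule: induct) (auto intro!: definable_intros)

lemma plus_assoc: "x \<oplus> y \<oplus> z = x \<oplus> (y \<oplus> z)"
  by (induct z rule: induct) (auto intro!: definable_intros)

lemma plus_left_commute: "x \<oplus> (y \<oplus> z) = y \<oplus> (x \<oplus> z)"
  by (metis plus_commute plus_assoc)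

lemmas plus_ac = plus_assoc plus_commute plus_left_commute

lemma zero_times [simp]: "\<zero> \<otimes> x = \<zero>"
  by (induct x rule: induct) (auto intro!: definable_intros)

lemma succ_times [simp]: "succ x \<otimes> y = x \<otimes> y \<oplus> y"
  by (induct y rule: induct) (auto intro!: definable_intros simp: plus_ac)

lemma times_commute: "x \<otimes> y = y \<otimes> x"
  by (induct y rule: induct) (auto intro!: definable_intros)

lemma distrib_left: "x \<otimes> (y \<oplus> z) = x \<otimes> y \<oplus> x \<otimes> z"
  by (induct z rule: induct) (auto intro!: definable_intros simp: plus_ac)

lemma distrib_right: "(y \<oplus> z) \<otimes> x = y \<otimes> x \<oplus> z \<otimes> x"
  by (metis distrib_left times_commute)

lemma times_assoc: "x \<otimes> y \<otimes> z = x \<otimes> (y \<otimes> z)"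
  by (induct z rule: induct) (auto intro!: definable_intros simp: distrib_left)

lemma times_left_commute: "x \<otimes> (y \<otimes> z) = y \<otimes> (x \<otimes> z)"
  by (metis times_commute times_assoc)

lemmas arith = plus_ac times_assoc times_commute times_left_commute distrib_left distrib_right

lemma plus_left_cancel [simp]: "x \<oplus> y = x \<oplus> z \<longleftrightarrow> y = z"
  by (induct x rule: induct) (auto intro!: definable_intros)

lemma plus_right_cancel [simp]: "y \<oplus> x = z \<oplus> x \<longleftrightarrow> y = z"
  by (simp add: plus_commute)

lemma zero_or_succ: "x = \<zero> \<or> (\<exists>y. x = succ y)"
  by (induct x rule: induct) (auto intro!: definable_intros)

lemma plus_eq_zero [simp]:
  "x \<oplus> y = \<zero> \<longleftrightarrow> x = \<zero> \<and> y = \<zero>" "\<zero> = x \<oplus> y \<longleftrightarrow> x = \<zero> \<and> y = \<zero>"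
  using zero_or_succ[of y] by auto

lemma less_iff: "x \<prec> y \<longleftrightarrow> (\<exists>d. y = x \<oplus> succ d)"
proof (induct y rule: induct)
  case (succ y)
  have "(\<exists>d. y = x \<oplus> d) \<longleftrightarrow> y = x \<or> (\<exists>d. y = x \<oplus> succ d)"
    by (metis plus_zero_right zero_or_succ)
  with succ show ?case by (auto simp: less_succ_iff)
qed (auto intro!: definable_intros)

definition leq (infix "\<preceq>" 50) where "x \<preceq> y \<longleftrightarrow> (\<exists>d. y = x \<oplus> d)"

lemma leq_iff: "x \<preceq> y \<longleftrightarrow> x \<prec> y \<or> x = y"
  unfolding leq_def less_iff by (metis plus_zero_right zero_or_succ)

lemma not_less: "\<not> x \<prec> y \<longleftrightarrow> y \<preceq> x"
proof -
  have "x \<prec> y \<or> y \<preceq> x"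
  proof (induct y rule: induct)
    case zero
    show ?case by (simp add: leq_def)
  next
    case (succ y)
    then show ?case by (auto simp: leq_iff less_succ_iff) (metis less_iff plus_succ_right plus_zero_right succ_plus zero_or_succ)
  qed (auto intro!: definable_intros simp: leq_iff)
  moreover have "\<not> (x \<prec> y \<and> y \<preceq> x)"
  proof
    assume "x \<prec> y \<and> y \<preceq> x"
    then obtain d d' where "y = x \<oplus> succ d" "x = y \<oplus> d'" unfolding leq_def less_iff by blast
    then have "y \<oplus> succ (d' \<oplus> d) = y \<oplus> \<zero>" by (simp add: plus_assoc)
    then show False by (simp only: plus_left_cancel succ_neq_zero)
  qed
  ultimately show ?thesis by blast
qed

sublocale order: linorder leq less
proof
  fix x y z
  show "x \<prec> y \<longleftrightarrow> x \<preceq> y \<and> \<not> y \<preceq> x" using leq_iff not_less by blast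
  show "x \<preceq> x" by (simp add: leq_iff)
  show "x \<preceq> z" if "x \<preceq> y" "y \<preceq> z" using that by (auto simp: leq_def plus_assoc)
  show "x = y" if "x \<preceq> y" "y \<preceq> x" using that leq_iff not_less by blast
  show "x \<preceq> y \<or> y \<preceq> x" using leq_iff not_less by blast
qed

lemma plus_leq_mono: "x \<preceq> x' \<Longrightarrow> y \<preceq> y' \<Longrightarrow> x \<oplus> y \<preceq> x' \<oplus> y'"
  unfolding leq_def by (metis plus_assoc plus_left_commute)

lemma times_leq_mono: "x \<preceq> x' \<Longrightarrow> y \<preceq> y' \<Longrightarrow> x \<otimes> y \<preceq> x' \<otimes> y'"
  unfolding leq_def by (metis distrib_left distrib_right plus_assoc)

lemma leq_plus [simp]: "x \<preceq> x \<oplus> y" "x \<preceq> y \<oplus> x"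
  unfolding leq_def by (auto intro: plus_commute)

lemma leq_times: "y \<noteq> \<zero> \<Longrightarrow> x \<preceq> x \<otimes> y" "y \<noteq> \<zero> \<Longrightarrow> x \<preceq> y \<otimes> x"
  using zero_or_succ[of y] by (auto simp: plus_commute)

lemma succ_leq_iff: "succ x \<preceq> y \<longleftrightarrow> x \<prec> y"
  unfolding leq_def less_iff by simp

subsection \<open>Pairing\<close>

text \<open>Cantor pairing with squares in place of triangular numbers: no division is involved, so
  this is a term of the language. It is injective but not surjective.\<close>

definition pair :: "'a \<Rightarrow> 'a \<Rightarrow> 'a" where "pair x y = (x \<oplus> y) \<otimes> (x \<oplus> y) \<oplus> x"

lemma pair_less:
  assumes "x \<oplus> y \<prec> x' \<oplus> y'"
  shows "pair x y \<prec> pair x' y'"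
proof -
  let ?s = "x \<oplus> y"
  have "pair x y \<prec> ?s \<otimes> ?s \<oplus> ?s \<oplus> succ ?s"
    unfolding pair_def less_iff by (intro exI[of _ "x \<oplus> y \<oplus> y"]) (simp add: plus_ac)
  also have "\<dots> = succ ?s \<otimes> succ ?s" by (simp add: plus_ac)
  also have "\<dots> \<preceq> (x' \<oplus> y') \<otimes> (x' \<oplus> y')" using assms by (intro times_leq_mono) (simp_all add: succ_leq_iff)
  also have "\<dots> \<preceq> pair x' y'" by (simp add: pair_def)
  finally show ?thesis .
qed

lemma pair_inject [simp]: "pair x y = pair x' y' \<longleftrightarrow> x = x' \<and> y = y'"
proof
  assume eq: "pair x y = pair x' y'"
  then have "x \<oplus> y = x' \<oplus> y'"
    using pair_less[of x y x' y'] pair_less[of x' y' x y] order.less_linear by auto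
  with eq show "x = x' \<and> y = y'" unfolding pair_def by auto
qed simp

lemma leq_pair: "x \<preceq> pair x y" "y \<preceq> pair x y"
proof -
  show "x \<preceq> pair x y" by (simp add: pair_def)
  show "y \<preceq> pair x y"
  proof (cases "x \<oplus> y = \<zero>")
    case True
    then show ?thesis by (simp add: leq_def)
  next
    case False
    then have "x \<oplus> y \<preceq> (x \<oplus> y) \<otimes> (x \<oplus> y)" by (rule leq_times)
    then show ?thesis unfolding pair_def
      by (meson leq_plus order.order_trans)
  qed
qed

lemma pair_mono: "x \<preceq> x' \<Longrightarrow> y \<preceq> y' \<Longrightarrow> pair x y \<preceq> pair x' y'"
  unfolding pair_def by (intro plus_leq_mono times_leq_mono)

subsection \<open>Coding finite sets\<close>

definition divides :: "'a \<Rightarrow> 'a \<Rightarrow> bool" where "divides x y \<longleftrightarrow> (\<exists>z. z \<otimes> x = y)"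

text \<open>The moduli of Goedel's beta function. A set will be coded by the product of the moduli
  of its members, with divisibility in place of remainders.\<close>

definition beta :: "'a \<Rightarrow> 'a \<Rightarrow> 'a" where "beta d i = succ (succ i \<otimes> d)"

lemma divides_times: "divides x y \<Longrightarrow> divides x (z \<otimes> y)"
  unfolding divides_def by (metis times_assoc)

lemma divides_plus_left:
  assumes "divides u (x \<oplus> y)" "divides u x"
  shows "divides u y"
proof -
  from assms obtain a b where a: "a \<otimes> u = x" and b: "b \<otimes> u = x \<oplus> y" by (auto simp: divides_def)
  show ?thesis
  proof (cases "b \<prec> a")
    case True
    then obtain k where k: "a = b \<oplus> succ k" by (auto simp: less_iff)
    have "b \<otimes> u = a \<otimes> u \<oplus> y" by (simp only: a b)
    then have "b \<otimes> u \<oplus> \<zero> = b \<otimes> u \<oplus> (succ k \<otimes> u \<oplus> y)"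
      by (simp only: k distrib_right plus_assoc plus_zero_right)
    then have "succ k \<otimes> u \<oplus> y = \<zero>" by (simp only: plus_left_cancel)
    then have "\<zero> \<otimes> u = y" by simp
    then show ?thesis unfolding divides_def by blast
  next
    case False
    then obtain k where k: "b = a \<oplus> k" by (auto simp: not_less leq_def)
    have "x \<oplus> k \<otimes> u = b \<otimes> u" by (simp only: k distrib_right a[symmetric])
    then have "x \<oplus> k \<otimes> u = x \<oplus> y" by (simp only: b)
    then show ?thesis by (auto simp: divides_def)
  qed
qed

text \<open>
  If \<open>k\<close> is the difference of \<open>i\<close> and \<open>j\<close>, then the moduli satisfy
  \<open>(i + 1) \<sqdot> beta d j = (j + 1) \<sqdot> beta d i \<plusminus> k\<close>, and \<open>k\<close> divides \<open>d\<close>, which is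
  invertible modulo \<open>beta d i\<close>.
\<close>

lemma beta_coprime:
  assumes d: "\<And>k. k \<prec> n \<Longrightarrow> k \<noteq> \<zero> \<Longrightarrow> divides k d"
    and ij: "i \<prec> n" "j \<prec> n" "i \<noteq> j"
    and div: "divides (beta d i) (c \<otimes> beta d j)"
  shows "divides (beta d i) c"
proof -
  have "\<exists>k. k \<prec> n \<and> k \<noteq> \<zero> \<and> divides (beta d i) (c \<otimes> k)"
  proof (cases "i \<prec> j")
    case True
    then obtain k' where j: "j = i \<oplus> succ k'" by (auto simp: less_iff)
    let ?k = "succ k'"
    have "(c \<otimes> succ j) \<otimes> beta d i = succ i \<otimes> (c \<otimes> beta d j) \<oplus> c \<otimes> ?k"
      unfolding j beta_def by (simp add: arith)
    then have "divides (beta d i) (succ i \<otimes> (c \<otimes> beta d j) \<oplus> c \<otimes> ?k)"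
      unfolding divides_def by blast
    then have "divides (beta d i) (c \<otimes> ?k)"
      by (rule divides_plus_left) (rule divides_times[OF div])
    moreover have "?k \<prec> n"
      using order.le_less_trans[OF leq_plus(2) ij(2)[unfolded j]] .
    ultimately show ?thesis by (intro exI[of _ ?k]) simp
  next
    case False
    with ij(3) have "j \<prec> i" by (simp add: not_less leq_iff)
    then obtain k' where i: "i = j \<oplus> succ k'" by (auto simp: less_iff)
    let ?k = "succ k'"
    have "succ i \<otimes> (c \<otimes> beta d j) = (c \<otimes> succ j) \<otimes> beta d i \<oplus> c \<otimes> ?k"
      unfolding i beta_def by (simp add: arith)
    with divides_times[OF div, of "succ i"]
    have "divides (beta d i) ((c \<otimes> succ j) \<otimes> beta d i \<oplus> c \<otimes> ?k)" by (simp only:)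
    moreover have "divides (beta d i) ((c \<otimes> succ j) \<otimes> beta d i)"
      unfolding divides_def by blast
    ultimately have "divides (beta d i) (c \<otimes> ?k)" by (rule divides_plus_left)
    moreover have "?k \<prec> n"
      using order.le_less_trans[OF leq_plus(2) ij(1)[unfolded i]] .
    ultimately show ?thesis by (intro exI[of _ ?k]) simp
  qed
  then obtain k where k: "k \<prec> n" "k \<noteq> \<zero>" "divides (beta d i) (c \<otimes> k)" by blast
  from d[OF k(1,2)] obtain l where l: "l \<otimes> k = d" unfolding divides_def by (rule exE)
  \<comment> \<open>The modulus divides \<open>c\<close> times \<open>succ i \<otimes> d\<close>,
    and also this number plus \<open>c\<close>, which is \<open>c\<close> times the modulus; their
    difference is \<open>c\<close>.\<close>
  have "succ i \<otimes> l \<otimes> (c \<otimes> k) = c \<otimes> (succ i \<otimes> d)"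
    unfolding l[symmetric] by (simp only: times_assoc times_commute times_left_commute)
  then have "divides (beta d i) (c \<otimes> (succ i \<otimes> d))"
    using divides_times[OF k(3), of "succ i \<otimes> l"] by simp
  moreover have "divides (beta d i) (c \<otimes> (succ i \<otimes> d) \<oplus> c)"
    unfolding divides_def by (rule exI[of _ c]) (simp add: beta_def)
  ultimately show ?thesis by (rule divides_plus_left[rotated])
qed

text \<open>Takes the place of a factorial, for which the language has no term. Divisibility is
  unfolded so that \<open>definable_intros\<close> applies.\<close>

lemma common_multiple: "\<exists>d. d \<noteq> \<zero> \<and> (\<forall>k. k \<prec> n \<longrightarrow> k \<noteq> \<zero> \<longrightarrow> (\<exists>z. z \<otimes> k = d))"
proof (induct n rule: induct)
  case zero
  show ?case by (auto intro: exI[of _ "succ \<zero>"])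
next
  case (succ n)
  then obtain d where d: "d \<noteq> \<zero>" "\<And>k. k \<prec> n \<Longrightarrow> k \<noteq> \<zero> \<Longrightarrow> divides k d"
    by (auto simp: divides_def)
  show ?case
  proof (cases "n = \<zero>")
    case True
    with d show ?thesis by (auto simp: less_succ_iff)
  next
    case False
    then have "n \<otimes> d \<noteq> \<zero>" using d(1) zero_or_succ[of n] by auto
    moreover have "divides k (n \<otimes> d)" if "k \<prec> succ n" "k \<noteq> \<zero>" for k
      using that d(2) by (auto simp: less_succ_iff intro: divides_times) (auto simp: divides_def times_commute)
    ultimately show ?thesis unfolding divides_def by blast
  qed
qed (intro definable_intros)

definition fin_set :: "'a \<Rightarrow> 'a \<Rightarrow> 'a \<Rightarrow> 'a set" where
  "fin_set c d n = {i. i \<prec> n \<and> divides (beta d i) c}"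

text \<open>Induction on \<open>j\<close>: the code of the members below \<open>j\<close> is
  multiplied by \<open>beta d j\<close> when \<open>j\<close> is a member, and coprimality keeps the
  other memberships unchanged.\<close>

lemma definable_set_coded:
  assumes X: "definable (\<lambda>e. e 0 \<in> X)" and bounded: "\<And>i. i \<in> X \<Longrightarrow> i \<prec> n"
  shows "\<exists>c d. X = fin_set c d n"
proof -
  obtain d where d: "d \<noteq> \<zero>" "\<And>k. k \<prec> n \<Longrightarrow> k \<noteq> \<zero> \<Longrightarrow> divides k d"
    using common_multiple[of n] by (auto simp: divides_def)
  have X': "definable (\<lambda>e. e k \<in> X)" for k
    by (rule definable_subst[OF X, of "\<lambda>e _. e k"]) (rule definable_intros)
  have "\<exists>c. \<forall>i. i \<prec> n \<longrightarrow> ((\<exists>z. z \<otimes> beta d i = c) \<longleftrightarrow> i \<in> X \<and> i \<prec> j)" for j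
  proof (induct j rule: induct)
    case zero
    \<comment> \<open>The empty product 1 is divisible by no modulus, because \<open>d\<close> is
      nonzero and so every modulus exceeds 1.\<close>
    have "z \<otimes> beta d i \<noteq> succ \<zero>" for z i
    proof
      assume *: "z \<otimes> beta d i = succ \<zero>"
      then obtain z' where z: "z = succ z'" using zero_or_succ[of z] by auto
      from * have "z' \<otimes> beta d i \<oplus> (succ i \<otimes> d) = \<zero>" by (simp add: z beta_def)
      with d(1) show False by simp
    qed
    then show ?case by (intro exI[of _ "succ \<zero>"]) simp
  next
    case (succ j)
    then obtain c where c: "\<And>i. i \<prec> n \<Longrightarrow> divides (beta d i) c \<longleftrightarrow> i \<in> X \<and> i \<prec> j"
      by (auto simp: divides_def)
    have "\<exists>c. \<forall>i. i \<prec> n \<longrightarrow> (divides (beta d i) c \<longleftrightarrow> i \<in> X \<and> i \<prec> succ j)"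
    proof (cases "j \<in> X")
      case True
      have "divides (beta d i) (c \<otimes> beta d j) \<longleftrightarrow> i \<in> X \<and> i \<prec> succ j" if i: "i \<prec> n" for i
      proof (cases "i = j")
        case True
        with \<open>j \<in> X\<close> show ?thesis by (auto simp: divides_def less_succ_iff)
      next
        case False
        have "divides (beta d i) (c \<otimes> beta d j) \<longleftrightarrow> divides (beta d i) c"
          using beta_coprime[OF d(2) i bounded[OF True] False] divides_times
          by (metis times_commute)
        with False c[OF i] show ?thesis by (simp add: less_succ_iff)
      qed
      then show ?thesis by blast
    next
      case False
      with c show ?thesis by (auto simp: less_succ_iff)
    qed
    then show ?case by (simp add: divides_def)
  qed (unfold beta_def, intro definable_intros X')
  from this[of n] bounded show ?thesis unfolding fin_set_def divides_def by blast
qed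

lemma collection:
  assumes R: "definable (\<lambda>e. R (e 0) (e 1))" and ex: "\<And>x. \<exists>y. R x y"
  shows "\<exists>C. \<forall>x. x \<prec> B \<longrightarrow> (\<exists>y. y \<prec> C \<and> R x y)"
proof (induct B rule: induct)
  case (succ B)
  then obtain C where C: "\<And>x. x \<prec> B \<Longrightarrow> \<exists>y. y \<prec> C \<and> R x y" by blast
  obtain y where y: "R B y" using ex by blast
  have "y \<prec> C \<oplus> succ y" "z \<prec> C \<Longrightarrow> z \<prec> C \<oplus> succ y" for z
    by (auto simp: less_iff plus_ac) (metis plus_assoc plus_succ_right succ_plus)
  with C y show ?case by (intro exI[of _ "C \<oplus> succ y"]) (metis less_succ_iff)
next
  case definable
  have R': "definable (\<lambda>e. R (e k) (e l))" for k l
  proof -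
    have "definable_fun (\<lambda>e. env2 (e k) (e l) n)" for n
      by (cases n) (auto intro: definable_fun_var)
    from definable_subst[OF R, of "\<lambda>e. env2 (e k) (e l)", OF this] show ?thesis by simp
  qed
  show ?case by (intro definable_intros R')
qed auto

end

section \<open>Positive relations and certificates\<close>

text \<open>All constructors are monotone. \<open>RKeep\<close> deletes the second entry of the
  environment and \<open>RDrop\<close> the first; \<open>RBall\<close> lets the first entry run
  through all smaller values; the atoms speak of the leading entries.\<close>

datatype rel = RAnd rel rel | ROr rel rel | REx rel | RBall rel | RKeep rel | RDrop rel
  | RZero | RSucc | RPlus | RTimes

definition nat_pair :: "nat \<Rightarrow> nat \<Rightarrow> nat" where "nat_pair x y = (x + y) * (x + y) + x"

abbreviation nat_node :: "nat \<Rightarrow> nat \<Rightarrow> nat \<Rightarrow> nat" where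
  "nat_node k p q \<equiv> nat_pair k (nat_pair p q)"

primrec rel_code :: "rel \<Rightarrow> nat" where
  "rel_code (RAnd p q) = nat_node 0 (rel_code p) (rel_code q)"
| "rel_code (ROr p q) = nat_node 1 (rel_code p) (rel_code q)"
| "rel_code (REx p) = nat_node 2 (rel_code p) 0"
| "rel_code (RBall p) = nat_node 3 (rel_code p) 0"
| "rel_code (RKeep p) = nat_node 4 (rel_code p) 0"
| "rel_code (RDrop p) = nat_node 5 (rel_code p) 0"
| "rel_code RZero = nat_node 6 0 0"
| "rel_code RSucc = nat_node 7 0 0"
| "rel_code RPlus = nat_node 8 0 0"
| "rel_code RTimes = nat_node 9 0 0"

text \<open>Appending False sends n to 2n+1 and appending True sends it to 2n+2, so parity reveals
  the last symbol and halving removes it. The program stands at the end, where it can be read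
  first.\<close>

primrec prefix_code :: "nat \<Rightarrow> nat \<Rightarrow> nat" where
  "prefix_code n 0 = Suc (n + n)"
| "prefix_code n (Suc k) = Suc (Suc (prefix_code n k + prefix_code n k))"

lemma string_nat_prefix_code:
  "string_nat (t @ False # replicate k True) = prefix_code (string_nat t) k"
proof (induction k)
  case 0
  show ?case by (simp add: string_nat_snoc)
next
  case (Suc k)
  have "t @ False # replicate (Suc k) True = (t @ False # replicate k True) @ [True]"
    by (simp add: replicate_append_same)
  with Suc show ?case by (simp only: string_nat_snoc) simp
qed

context PA_model
begin

primrec num :: "nat \<Rightarrow> 'a" where
  "num 0 = \<zero>"
| "num (Suc n) = succ (num n)"

lemma eval_numeral_tm [simp]: "eval e (numeral_tm n) = num n"
  by (induction n) auto

lemma num_inject [simp]: "num m = num n \<longleftrightarrow> m = n"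
proof (induction m arbitrary: n)
  case 0
  show ?case by (cases n) auto
next
  case (Suc m)
  then show ?case by (cases n) auto
qed

lemma num_plus: "num (m + n) = num m \<oplus> num n"
  by (induction n) auto

lemma num_times: "num (m * n) = num m \<otimes> num n"
  by (induction n) (auto simp: num_plus plus_commute)

lemma num_nat_pair [simp]: "num (nat_pair m n) = pair (num m) (num n)"
  by (simp add: nat_pair_def pair_def num_plus num_times)

declare num.simps [simp del]

abbreviation node :: "'a \<Rightarrow> 'a \<Rightarrow> 'a \<Rightarrow> 'a" where "node k p q \<equiv> pair k (pair p q)"

text \<open>
  Environments are coded as nested pairs. Since \<open>pair \<zero> \<zero> = \<zero>\<close>, the number \<open>\<zero>\<close>
  codes the environment that is constantly \<open>\<zero>\<close>, and every coded environment has at least three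
  leading components.
\<close>

abbreviation env3 :: "'a \<Rightarrow> 'a \<Rightarrow> 'a \<Rightarrow> 'a \<Rightarrow> 'a" where
  "env3 x y w a \<equiv> pair x (pair y (pair w a))"

text \<open>Numbers not of the form \<open>env3\<close> satisfy every relation vacuously:
  certificates put no condition on facts about them, so soundness forces this choice.\<close>

primrec holds :: "rel \<Rightarrow> 'a \<Rightarrow> bool" where
  "holds (RAnd p q) e \<longleftrightarrow> (\<forall>x y w a. e = env3 x y w a \<longrightarrow> holds p e \<and> holds q e)"
| "holds (ROr p q) e \<longleftrightarrow> (\<forall>x y w a. e = env3 x y w a \<longrightarrow> holds p e \<or> holds q e)"
| "holds (REx p) e \<longleftrightarrow> (\<forall>x y w a. e = env3 x y w a \<longrightarrow> (\<exists>u. holds p (pair u e)))"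
| "holds (RBall p) e \<longleftrightarrow> (\<forall>x y w a. e = env3 x y w a \<longrightarrow> (\<forall>u. u \<prec> x \<longrightarrow> holds p (env3 u y w a)))"
| "holds (RKeep p) e \<longleftrightarrow> (\<forall>x y w a. e = env3 x y w a \<longrightarrow> holds p (pair x (pair w a)))"
| "holds (RDrop p) e \<longleftrightarrow> (\<forall>x y w a. e = env3 x y w a \<longrightarrow> holds p (pair y (pair w a)))"
| "holds RZero e \<longleftrightarrow> (\<forall>x y w a. e = env3 x y w a \<longrightarrow> x = \<zero>)"
| "holds RSucc e \<longleftrightarrow> (\<forall>x y w a. e = env3 x y w a \<longrightarrow> y = succ x)"
| "holds RPlus e \<longleftrightarrow> (\<forall>x y w a. e = env3 x y w a \<longrightarrow> w = x \<oplus> y)"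
| "holds RTimes e \<longleftrightarrow> (\<forall>x y w a. e = env3 x y w a \<longrightarrow> w = x \<otimes> y)"

lemma definable_fun_pair:
  "definable_fun f \<Longrightarrow> definable_fun g \<Longrightarrow> definable_fun (\<lambda>e. pair (f e) (g e))"
  unfolding pair_def by (intro definable_intros)

lemma definable_holds_var: "definable (\<lambda>e. holds r (e 0))"
proof (induction r)
  fix p q
  assume IH: "definable (\<lambda>e. holds p (e 0))" "definable (\<lambda>e. holds q (e 0))"
  have p: "definable (\<lambda>e. holds p (f e))" and q: "definable (\<lambda>e. holds q (f e))"
    if "definable_fun f" for f
    using definable_subst[OF IH(1), of "\<lambda>e _. f e"] definable_subst[OF IH(2), of "\<lambda>e _. f e"] that
    by simp_all
  show "definable (\<lambda>e. holds (RAnd p q) (e 0))" "definable (\<lambda>e. holds (ROr p q) (e 0))"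
    unfolding holds.simps by (intro definable_intros definable_fun_pair p q)+
next
  fix p
  assume IH: "definable (\<lambda>e. holds p (e 0))"
  have p: "definable (\<lambda>e. holds p (f e))" if "definable_fun f" for f
    using definable_subst[OF IH, of "\<lambda>e _. f e"] that by simp
  show "definable (\<lambda>e. holds (REx p) (e 0))" "definable (\<lambda>e. holds (RBall p) (e 0))"
    "definable (\<lambda>e. holds (RKeep p) (e 0))" "definable (\<lambda>e. holds (RDrop p) (e 0))"
    unfolding holds.simps by (intro definable_intros definable_fun_pair p)+
qed (unfold holds.simps, (intro definable_intros definable_fun_pair)+)

lemma definable_holds: "definable_fun f \<Longrightarrow> definable (\<lambda>e. holds r (f e))"
  using definable_subst[OF definable_holds_var, of "\<lambda>e _. f e"] by simp

text \<open>
  A certificate is a set of facts \<open>pair (node k p q) e\<close>, read ``the relation with code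
  \<open>node k p q\<close> holds in the environment \<open>e\<close>'', each of which follows from other facts in the set. The
  tag 10 belongs to the decoder: \<open>node 10 p q\<close> reads off the prefix code \<open>q\<close> with \<open>p\<close> as counter.
\<close>

definition justified :: "'a set \<Rightarrow> 'a \<Rightarrow> 'a \<Rightarrow> 'a \<Rightarrow> 'a \<Rightarrow> 'a \<Rightarrow> 'a \<Rightarrow> 'a \<Rightarrow> bool" where
  "justified X k p q x y w a \<longleftrightarrow>
    (k = num 0 \<longrightarrow> pair p (env3 x y w a) \<in> X \<and> pair q (env3 x y w a) \<in> X) \<and>
    (k = num 1 \<longrightarrow> pair p (env3 x y w a) \<in> X \<or> pair q (env3 x y w a) \<in> X) \<and>
    (k = num 2 \<longrightarrow> (\<exists>u. pair p (pair u (env3 x y w a)) \<in> X)) \<and>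
    (k = num 3 \<longrightarrow> (\<forall>u. u \<prec> x \<longrightarrow> pair p (env3 u y w a) \<in> X)) \<and>
    (k = num 4 \<longrightarrow> pair p (pair x (pair w a)) \<in> X) \<and>
    (k = num 5 \<longrightarrow> pair p (pair y (pair w a)) \<in> X) \<and>
    (k = num 6 \<longrightarrow> x = \<zero>) \<and>
    (k = num 7 \<longrightarrow> y = succ x) \<and>
    (k = num 8 \<longrightarrow> w = x \<oplus> y) \<and>
    (k = num 9 \<longrightarrow> w = x \<otimes> y) \<and>
    (k = num 10 \<longrightarrow> (\<forall>u.
      (q = succ (u \<oplus> u) \<longrightarrow> pair p (pair u (env3 x y w a)) \<in> X) \<and>
      (q = succ (succ (u \<oplus> u)) \<longrightarrow> pair (node k (succ p) u) (env3 x y w a) \<in> X)))"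

definition certificate :: "'a set \<Rightarrow> bool" where
  "certificate X \<longleftrightarrow> (\<forall>k p q x y w a.
    pair (node k p q) (env3 x y w a) \<in> X \<longrightarrow> justified X k p q x y w a)"

text \<open>Induction on the relation unwinds a fact finitely often, so \<open>X\<close> may be any
  set, coded or not.\<close>

lemma certificate_sound:
  assumes X: "certificate X"
  shows "pair (num (rel_code r)) e \<in> X \<Longrightarrow> holds r e"
proof -
  have J: "justified X k p q x y w a" if "pair (node k p q) (env3 x y w a) \<in> X" for k p q x y w a
    using X that unfolding certificate_def by blast
  show "pair (num (rel_code r)) e \<in> X \<Longrightarrow> holds r e"
    by (induction r arbitrary: e) (auto dest!: J simp: justified_def, blast)
qed

text \<open>Codable sets described without their codes, since unions would be awkward on triples
  \<open>c\<close>, \<open>d\<close>, \<open>n\<close>.\<close>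

definition bounded_definable :: "'a set \<Rightarrow> bool" where
  "bounded_definable X \<longleftrightarrow> definable (\<lambda>e. e 0 \<in> X) \<and> (\<exists>n. \<forall>z\<in>X. z \<prec> n)"

lemma bounded_definable_coded: "bounded_definable X \<Longrightarrow> \<exists>c d n. X = fin_set c d n"
  unfolding bounded_definable_def using definable_set_coded by blast

lemma bounded_definable_Un:
  assumes "bounded_definable X" "bounded_definable Y"
  shows "bounded_definable (X \<union> Y)"
proof -
  from assms obtain m n where mn: "\<And>z. z \<in> X \<Longrightarrow> z \<prec> m" "\<And>z. z \<in> Y \<Longrightarrow> z \<prec> n"
    unfolding bounded_definable_def by blast
  have "\<forall>z\<in>X \<union> Y. z \<prec> m \<oplus> n"
    using order.less_le_trans[OF mn(1) leq_plus(1)[of m n]] order.less_le_trans[OF mn(2) leq_plus(2)[of n m]]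
    by blast
  moreover have "definable (\<lambda>e. e 0 \<in> X \<union> Y)"
    unfolding Un_iff by (intro definable_disj) (use assms in \<open>auto simp: bounded_definable_def\<close>)
  ultimately show ?thesis unfolding bounded_definable_def by blast
qed

lemma bounded_definable_singleton: "bounded_definable {z}"
proof -
  have "definable (\<lambda>e. e 0 \<in> {z})" unfolding singleton_iff by (intro definable_intros)
  moreover have "z \<prec> succ z" by (simp add: less_succ_iff)
  ultimately show ?thesis unfolding bounded_definable_def by auto
qed

definition facts :: "rel \<Rightarrow> 'a \<Rightarrow> 'a set" where
  "facts r B = {pair (num (rel_code r)) e | e. e \<prec> B \<and> holds r e}"

lemma bounded_definable_facts: "bounded_definable (facts r B)"
proof -
  have "definable (\<lambda>e. e 0 \<in> facts r B)"
    unfolding facts_def mem_Collect_eq by (intro definable_intros definable_fun_pair definable_holds)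
  moreover have "pair (num (rel_code r)) e \<prec> succ (pair (num (rel_code r)) B)" if "e \<prec> B" for e
    using pair_mono[OF order.order_refl order.less_imp_le[OF that]] by (simp only: less_succ_iff leq_iff)
  then have "\<forall>z\<in>facts r B. z \<prec> succ (pair (num (rel_code r)) B)"
    by (auto simp: facts_def)
  ultimately show ?thesis unfolding bounded_definable_def by blast
qed

lemma justified_mono:
  assumes "justified X k p q x y w a" "X \<subseteq> Y"
  shows "justified Y k p q x y w a"
  using assms(1) unfolding justified_def
  by (elim conj_forward; use assms(2) in blast)

lemma certificate_Un:
  assumes "certificate X"
    and "\<And>k p q x y w a. pair (node k p q) (env3 x y w a) \<in> Y \<Longrightarrow> justified (X \<union> Y) k p q x y w a"
  shows "certificate (X \<union> Y)"
  unfolding certificate_def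
proof (intro allI impI)
  fix k p q x y w a
  assume "pair (node k p q) (env3 x y w a) \<in> X \<union> Y"
  then show "justified (X \<union> Y) k p q x y w a"
  proof
    assume "pair (node k p q) (env3 x y w a) \<in> X"
    with assms(1) have "justified X k p q x y w a" unfolding certificate_def by blast
    then show ?thesis by (rule justified_mono) simp
  qed (rule assms(2))
qed

lemma certificate_Un_certificate:
  assumes "certificate X" "certificate Y"
  shows "certificate (X \<union> Y)"
proof (rule certificate_Un[OF assms(1)])
  fix k p q x y w a
  assume "pair (node k p q) (env3 x y w a) \<in> Y"
  with assms(2) have "justified Y k p q x y w a" unfolding certificate_def by blast
  then show "justified (X \<union> Y) k p q x y w a" by (rule justified_mono) simp
qed

lemma pair_less_mono: "x \<preceq> x' \<Longrightarrow> y \<preceq> y' \<Longrightarrow> pair x' y' \<prec> B \<Longrightarrow> pair x y \<prec> B"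
  using pair_mono order.le_less_trans by blast

text \<open>
  Only an existential quantifier requires facts about environments beyond \<open>B\<close>; collection bounds
  the witnesses.
\<close>

lemma certificate_complete:
  "\<exists>X. bounded_definable X \<and> certificate X \<and> facts r B \<subseteq> X"
proof (induction r arbitrary: B)
  have add: "\<exists>X. bounded_definable X \<and> certificate X \<and> facts r B \<subseteq> X"
    if "bounded_definable X" "certificate X"
      "\<And>k p q x y w a. node k p q = num (rel_code r) \<Longrightarrow> holds r (env3 x y w a) \<Longrightarrow> env3 x y w a \<prec> B \<Longrightarrow>
        justified (X \<union> facts r B) k p q x y w a" for r B X
  proof (intro exI conjI)
    show "bounded_definable (X \<union> facts r B)"
      using that(1) by (intro bounded_definable_Un bounded_definable_facts)
    show "certificate (X \<union> facts r B)"
    proof (rule certificate_Un[OF that(2)])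
      fix k p q x y w a
      assume "pair (node k p q) (env3 x y w a) \<in> facts r B"
      then show "justified (X \<union> facts r B) k p q x y w a"
        by (intro that(3)) (auto simp: facts_def)
    qed
  qed (rule Un_upper2)
  have empty: "bounded_definable {}" "certificate {}"
    using definable_False by (auto simp: bounded_definable_def certificate_def)
  have facts: "pair (num (rel_code r)) e \<in> X" if "facts r B \<subseteq> X" "e \<prec> B" "holds r e" for r B X e
    using that by (auto simp: facts_def)
  {
    case (RAnd p q)
    obtain X where X: "bounded_definable X" "certificate X" "facts p B \<subseteq> X" using RAnd(1) by blast
    obtain Y where Y: "bounded_definable Y" "certificate Y" "facts q B \<subseteq> Y" using RAnd(2) by blast
    show ?case
      by (rule add[OF bounded_definable_Un[OF X(1) Y(1)] certificate_Un_certificate[OF X(2) Y(2)]])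
        (auto simp: justified_def facts[OF X(3)] facts[OF Y(3)])
  next
    case (ROr p q)
    obtain X where X: "bounded_definable X" "certificate X" "facts p B \<subseteq> X" using ROr(1) by blast
    obtain Y where Y: "bounded_definable Y" "certificate Y" "facts q B \<subseteq> Y" using ROr(2) by blast
    show ?case
      by (rule add[OF bounded_definable_Un[OF X(1) Y(1)] certificate_Un_certificate[OF X(2) Y(2)]])
        (auto simp: justified_def dest: facts[OF X(3)] facts[OF Y(3)])
  next
    case (REx p)
    \<comment> \<open>Collection expects a total relation, so \<open>R\<close> accepts any
      \<open>u\<close> when \<open>REx p\<close> fails.\<close>
    define R where "R e u \<longleftrightarrow> holds (REx p) e \<longrightarrow>
      (\<forall>x y w a. e = env3 x y w a \<longrightarrow> holds p (pair u e))" for e u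
    have "definable (\<lambda>e. R (e 0) (e 1))"
      unfolding R_def by (intro definable_intros definable_fun_pair definable_holds)
    moreover have "\<exists>u. R e u" for e
      unfolding R_def by (cases "\<exists>x y w a. e = env3 x y w a") auto
    ultimately obtain C where C: "\<And>e. e \<prec> B \<Longrightarrow> \<exists>u. u \<prec> C \<and> R e u"
      using collection[of R B] by blast
    obtain X where X: "bounded_definable X" "certificate X" "facts p (succ (pair C B)) \<subseteq> X"
      using REx by blast
    have "\<exists>u. pair (num (rel_code p)) (pair u (env3 x y w a)) \<in> X"
      if h: "holds (REx p) (env3 x y w a)" and B: "env3 x y w a \<prec> B" for x y w a
    proof -
      from C[OF B] obtain u where u: "u \<prec> C" "holds p (pair u (env3 x y w a))"
        using h unfolding R_def by blast
      have "pair u (env3 x y w a) \<prec> succ (pair C B)"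
        using pair_mono[OF order.less_imp_le[OF u(1)] order.less_imp_le[OF B]]
        by (simp add: less_succ_iff leq_iff)
      with u(2) show ?thesis using facts[OF X(3)] by blast
    qed
    then show ?case by (intro add[OF X(1,2)]) (simp add: justified_def, blast)
  next
    case (RBall p)
    then obtain X where X: "bounded_definable X" "certificate X" "facts p B \<subseteq> X" by blast
    have "env3 u y w a \<prec> B" if "env3 x y w a \<prec> B" "u \<prec> x" for u x y w a
      by (rule pair_less_mono[OF order.less_imp_le[OF that(2)] order.order_refl that(1)])
    then show ?case
      by (intro add[OF X(1,2)]) (simp add: justified_def facts[OF X(3)])
  next
    case (RKeep p)
    then obtain X where X: "bounded_definable X" "certificate X" "facts p B \<subseteq> X" by blast
    have "pair x (pair w a) \<prec> B" if "env3 x y w a \<prec> B" for x y w a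
      by (rule pair_less_mono[OF order.order_refl leq_pair(2) that])
    then show ?case
      by (intro add[OF X(1,2)]) (simp add: justified_def facts[OF X(3)])
  next
    case (RDrop p)
    then obtain X where X: "bounded_definable X" "certificate X" "facts p B \<subseteq> X" by blast
    have "pair y (pair w a) \<prec> B" if "env3 x y w a \<prec> B" for x y w a
      by (rule order.le_less_trans[OF leq_pair(2) that])
    then show ?case
      by (intro add[OF X(1,2)]) (simp add: justified_def facts[OF X(3)])
  next
    case RZero
    show ?case by (rule add[OF empty]) (simp add: justified_def)
  next
    case RSucc
    show ?case by (rule add[OF empty]) (simp add: justified_def)
  next
    case RPlus
    show ?case by (rule add[OF empty]) (simp add: justified_def)
  next
    case RTimes
    show ?case by (rule add[OF empty]) (simp add: justified_def)
  }
qed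


section \<open>Decoding the program from the prefix code\<close>

lemma double_inject [simp]: "u \<oplus> u = v \<oplus> v \<longleftrightarrow> u = v"
proof -
  have "u \<oplus> u \<noteq> v \<oplus> v" if uv: "u \<prec> v" for u v
  proof -
    obtain d where "v = u \<oplus> succ d" using uv by (auto simp: less_iff)
    then have "v \<oplus> v = u \<oplus> u \<oplus> succ (succ (d \<oplus> d))" by (simp add: plus_ac)
    then show ?thesis by (metis plus_left_cancel plus_zero_right succ_neq_zero(1))
  qed
  then show ?thesis by (metis order.less_linear)
qed

lemma double_neq_succ_double [simp]: "u \<oplus> u \<noteq> succ (v \<oplus> v)" "succ (v \<oplus> v) \<noteq> u \<oplus> u"
proof -
  show "u \<oplus> u \<noteq> succ (v \<oplus> v)"
  proof (cases "u \<preceq> v")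
    case True
    then obtain d where "v = u \<oplus> d" by (auto simp: leq_def)
    then have "succ (v \<oplus> v) = u \<oplus> u \<oplus> succ (d \<oplus> d)" by (simp add: plus_ac)
    then show ?thesis by (metis plus_left_cancel plus_zero_right succ_neq_zero(1))
  next
    case False
    then obtain d where "u = v \<oplus> succ d" by (auto simp: less_iff not_less[symmetric])
    then have "u \<oplus> u = succ (v \<oplus> v) \<oplus> succ (d \<oplus> d)" by (simp add: plus_ac)
    then show ?thesis by (metis plus_left_cancel plus_zero_right succ_neq_zero(1))
  qed
  then show "succ (v \<oplus> v) \<noteq> u \<oplus> u" by metis
qed

lemma pair_zero: "pair \<zero> \<zero> = \<zero>"
  by (simp add: pair_def)

lemma env3_zero: "env3 \<zero> \<zero> \<zero> \<zero> = \<zero>"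
  by (simp only: pair_zero)

abbreviation decoder_fact :: "'a \<Rightarrow> 'a \<Rightarrow> 'a" where
  "decoder_fact p q \<equiv> pair (node (num 10) p q) \<zero>"

text \<open>The counter records the True symbols read so far. At the separator False its value
  becomes the code of a relation, and the remaining number becomes the input, pushed on the zero
  environment.\<close>

lemma decoder_sound:
  assumes X: "certificate X"
  shows "decoder_fact (num j) (num (prefix_code x k)) \<in> X \<Longrightarrow>
    pair (num (j + k)) (pair (num x) \<zero>) \<in> X"
proof (induction k arbitrary: j)
  case 0
  then have "pair (node (num 10) (num j) (succ (num x \<oplus> num x))) (env3 \<zero> \<zero> \<zero> \<zero>) \<in> X"
    by (simp only: prefix_code.simps num.simps num_plus env3_zero)
  with X have "justified X (num 10) (num j) (succ (num x \<oplus> num x)) \<zero> \<zero> \<zero> \<zero>"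
    unfolding certificate_def by blast
  then have "pair (num j) (pair (num x) (env3 \<zero> \<zero> \<zero> \<zero>)) \<in> X" unfolding justified_def by blast
  then show ?case by (simp only: env3_zero add_0_right)
next
  case (Suc k)
  let ?u = "num (prefix_code x k)"
  from Suc.prems have "pair (node (num 10) (num j) (succ (succ (?u \<oplus> ?u)))) (env3 \<zero> \<zero> \<zero> \<zero>) \<in> X"
    by (simp only: prefix_code.simps num.simps num_plus env3_zero)
  with X have "justified X (num 10) (num j) (succ (succ (?u \<oplus> ?u))) \<zero> \<zero> \<zero> \<zero>"
    unfolding certificate_def by blast
  then have "pair (node (num 10) (succ (num j)) ?u) (env3 \<zero> \<zero> \<zero> \<zero>) \<in> X"
    unfolding justified_def by blast
  then have "decoder_fact (num (Suc j)) ?u \<in> X" by (simp only: env3_zero num.simps)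
  then show ?case using Suc.IH[of "Suc j"] by simp
qed

lemma num_prefix_code:
  "num (prefix_code x 0) = succ (num x \<oplus> num x)"
  "num (prefix_code x (Suc k)) = succ (succ (num (prefix_code x k) \<oplus> num (prefix_code x k)))"
  by (simp_all add: num.simps num_plus)

text \<open>The decoding steps are added from the last to the first, one fact each; injectivity and
  parity of doubling exclude any other reading of a number.\<close>

lemma decoder_complete:
  assumes "bounded_definable X" "certificate X" "pair (num (j + k)) (pair (num x) \<zero>) \<in> X"
  shows "\<exists>Y. bounded_definable Y \<and> certificate Y \<and> decoder_fact (num j) (num (prefix_code x k)) \<in> Y"
  using assms
proof (induction k arbitrary: j X)
  case 0
  let ?Y = "X \<union> {decoder_fact (num j) (num (prefix_code x 0))}"
  have "certificate ?Y"
    by (rule certificate_Un[OF 0(2)])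
      (use 0(3) in \<open>auto simp: justified_def num_prefix_code pair_zero
        simp del: prefix_code.simps\<close>)
  moreover have "bounded_definable ?Y"
    by (intro bounded_definable_Un bounded_definable_singleton 0(1))
  ultimately show ?case by blast
next
  case (Suc k)
  have "pair (num (Suc j + k)) (pair (num x) \<zero>) \<in> X" using Suc.prems(3) by simp
  then obtain Z where Z: "bounded_definable Z" "certificate Z"
    "decoder_fact (num (Suc j)) (num (prefix_code x k)) \<in> Z"
    using Suc.IH[OF Suc.prems(1,2)] by blast
  let ?Y = "Z \<union> {decoder_fact (num j) (num (prefix_code x (Suc k)))}"
  have "certificate ?Y"
    by (rule certificate_Un[OF Z(2)])
      (use Z(3) in \<open>auto simp: justified_def num_prefix_code num.simps(2)[of j] pair_zero
        simp del: prefix_code.simps\<close>)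
  moreover have "bounded_definable ?Y"
    by (intro bounded_definable_Un bounded_definable_singleton Z(1))
  ultimately show ?case by blast
qed

theorem certificate_iff_holds:
  "(\<exists>c d n. certificate (fin_set c d n) \<and>
      decoder_fact \<zero> (num (prefix_code x (rel_code r))) \<in> fin_set c d n)
    \<longleftrightarrow> holds r (pair (num x) \<zero>)"
  (is "?L \<longleftrightarrow> ?R")
proof
  assume ?L
  then obtain X where "certificate X" "decoder_fact (num 0) (num (prefix_code x (rel_code r))) \<in> X"
    by (auto simp: num.simps)
  then show ?R by (metis add_0 certificate_sound decoder_sound)
next
  assume ?R
  obtain X where X: "bounded_definable X" "certificate X" "facts r (succ (pair (num x) \<zero>)) \<subseteq> X"
    using certificate_complete by blast
  with \<open>?R\<close> have "pair (num (0 + rel_code r)) (pair (num x) \<zero>) \<in> X"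
    by (auto simp: facts_def less_succ_iff)
  from decoder_complete[OF X(1,2) this] show ?L
    by (metis bounded_definable_coded num.simps(1))
qed

section \<open>Environments as lists padded with zeros\<close>

primrec enc :: "'a list \<Rightarrow> 'a" where
  "enc [] = \<zero>"
| "enc (x # xs) = pair x (enc xs)"

primrec look :: "'a list \<Rightarrow> nat \<Rightarrow> 'a" where
  "look [] = (\<lambda>_. \<zero>)"
| "look (x # xs) = case_nat x (look xs)"

lemma enc_unfold: "enc xs = pair (look xs 0) (enc (tl xs))"
  by (cases xs) (auto simp: pair_zero)

lemma look_tl: "look (tl xs) n = look xs (Suc n)"
  by (cases xs) auto

lemma enc_env3: "\<exists>a. enc xs = env3 (look xs 0) (look xs 1) (look xs 2) a"
  using enc_unfold[of xs] enc_unfold[of "tl xs"] enc_unfold[of "tl (tl xs)"]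
  by (simp add: look_tl numeral_2_eq_2)

lemma holds_RAnd: "holds (RAnd p q) (enc xs) \<longleftrightarrow> holds p (enc xs) \<and> holds q (enc xs)"
  and holds_ROr: "holds (ROr p q) (enc xs) \<longleftrightarrow> holds p (enc xs) \<or> holds q (enc xs)"
  and holds_REx: "holds (REx p) (enc xs) \<longleftrightarrow> (\<exists>u. holds p (enc (u # xs)))"
  using enc_env3[of xs] by auto

lemma holds_RBall: "holds (RBall p) (enc (x # xs)) \<longleftrightarrow> (\<forall>u. u \<prec> x \<longrightarrow> holds p (enc (u # xs)))"
  using enc_env3[of "x # xs"] by auto

lemma holds_RKeep: "holds (RKeep p) (enc (x # y # xs)) \<longleftrightarrow> holds p (enc (x # xs))"
  using enc_env3[of "x # y # xs"] by auto

lemma holds_RDrop: "holds (RDrop p) (enc (x # xs)) \<longleftrightarrow> holds p (enc xs)"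
  using enc_env3[of "x # xs"] by auto

lemma holds_atoms:
  "holds RZero (enc (x # xs)) \<longleftrightarrow> x = \<zero>"
  "holds RSucc (enc (x # y # xs)) \<longleftrightarrow> y = succ x"
  "holds RPlus (enc (x # y # w # xs)) \<longleftrightarrow> w = x \<oplus> y"
  "holds RTimes (enc (x # y # w # xs)) \<longleftrightarrow> w = x \<otimes> y"
  using enc_env3[of "x # xs"] enc_env3[of "x # y # xs"] enc_env3[of "x # y # w # xs"]
  by auto

declare holds.simps [simp del] enc.simps [simp del]

lemmas holds_enc = holds_RAnd holds_ROr holds_REx holds_RBall holds_RKeep holds_RDrop holds_atoms

end

section \<open>Translating bounded formulas into positive relations\<close>

text \<open>Equality is \<open>y = 0 + x\<close> and the order is \<open>y = succ d + x\<close>,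
  with the auxiliary numbers pushed as witnesses; falsity is a zero that is a successor.\<close>

definition REq :: rel where "REq = REx (RAnd RZero RPlus)"

definition RLess :: rel where "RLess = REx (REx (RAnd RSucc (RDrop RPlus)))"

definition RFalse :: rel where "RFalse = REx (RAnd RZero (REx RSucc))"

definition RApply2 :: "rel \<Rightarrow> rel \<Rightarrow> rel \<Rightarrow> rel" where
  "RApply2 r p q = REx (REx (RAnd r (RAnd (RKeep p) (RDrop q))))"

text \<open>The head of the environment is the claimed value and the tail is the assignment. In the
  variable case each \<open>RKeep\<close> skips one variable; in the compound cases it hides the
  claimed value from the subterms.\<close>

primrec value_rel :: "tm \<Rightarrow> rel" where
  "value_rel (Var n) = (RKeep ^^ n) REq"
| "value_rel Zero = RZero"
| "value_rel (Succ t) = REx (RAnd RSucc (RKeep (value_rel t)))"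
| "value_rel (Plus s t) = RApply2 RPlus (RKeep (value_rel s)) (RKeep (value_rel t))"
| "value_rel (Times s t) = RApply2 RTimes (RKeep (value_rel s)) (RKeep (value_rel t))"

text \<open>
  \<open>pos_rel\<close> is meaningful on \<open>Delta0\<close> formulas only, where \<open>s\<close> is \<open>Var 0\<close> and \<open>t\<close> a lifted
  term in the fifth equation; \<open>neg_rel\<close> also treats an unbounded universal prefix.
\<close>

fun pos_rel :: "fm \<Rightarrow> rel" and neg_rel :: "fm \<Rightarrow> rel" where
  "pos_rel Bot = RFalse"
| "pos_rel (Eq s t) = RApply2 REq (value_rel s) (value_rel t)"
| "pos_rel (Less s t) = RApply2 RLess (value_rel s) (value_rel t)"
| "pos_rel (Imp p q) = ROr (neg_rel p) (pos_rel q)"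
| "pos_rel (All (Imp (Less s t) p)) =
    REx (REx (RAnd (value_rel t) (RBall (RKeep (pos_rel p)))))"
| "pos_rel (All p) = RFalse"
| "neg_rel Bot = REx RZero"
| "neg_rel (Eq s t) = ROr (pos_rel (Less s t)) (pos_rel (Less t s))"
| "neg_rel (Less s t) = ROr (pos_rel (Eq s t)) (pos_rel (Less t s))"
| "neg_rel (Imp p q) = RAnd (pos_rel p) (neg_rel q)"
| "neg_rel (All p) = REx (neg_rel p)"

context PA_model
begin

lemma holds_REq: "holds REq (enc (x # y # xs)) \<longleftrightarrow> x = y"
  by (auto simp: REq_def holds_enc)

lemma holds_RLess: "holds RLess (enc (x # y # xs)) \<longleftrightarrow> x \<prec> y"
proof -
  have "holds RLess (enc (x # y # xs)) \<longleftrightarrow> (\<exists>d. y = succ d \<oplus> x)"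
    by (auto simp: RLess_def holds_enc)
  then show ?thesis by (simp add: less_iff plus_commute)
qed

lemma holds_RFalse: "\<not> holds RFalse (enc xs)"
  by (auto simp: RFalse_def holds_enc)

lemma holds_RApply2: "holds (RApply2 r p q) (enc xs) \<longleftrightarrow>
    (\<exists>y x. holds r (enc (x # y # xs)) \<and> holds p (enc (x # xs)) \<and> holds q (enc (y # xs)))"
  by (auto simp: RApply2_def holds_enc)

lemma holds_value_rel: "holds (value_rel t) (enc (v # xs)) \<longleftrightarrow> v = eval (look xs) t"
proof (induction t arbitrary: v xs)
  case (Var n)
  show ?case
  proof (induction n arbitrary: xs)
    case 0
    have "enc (v # xs) = enc (v # look xs 0 # tl xs)"
      by (simp add: enc.simps flip: enc_unfold)
    then show ?case by (simp add: holds_REq)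
  next
    case (Suc n)
    have "enc (v # xs) = enc (v # look xs 0 # tl xs)"
      by (simp add: enc.simps flip: enc_unfold)
    with Suc show ?case by (simp add: holds_RKeep look_tl)
  qed
qed (auto simp: holds_enc holds_RApply2)

lemma holds_pos_neg_rel:
  "Delta0 p \<Longrightarrow> (holds (pos_rel p) (enc xs) \<longleftrightarrow> sat (look xs) p) \<and>
     (holds (neg_rel p) (enc xs) \<longleftrightarrow> \<not> sat (look xs) p)"
proof (induction arbitrary: xs rule: Delta0.induct)
  case (5 p t)
  \<comment> \<open>For the bounded quantifier \<open>pos_rel\<close> pushes a dummy and then the
    value of the bound: the lifted term ignores the dummy, and \<open>RKeep\<close> deletes it
    before \<open>p\<close> is examined.\<close>
  have "eval (case_nat x (look xs)) (lift_tm t) = eval (look xs) t" for x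
    by (simp add: eval_subst)
  then show ?case by (simp add: holds_enc holds_value_rel holds_RApply2 holds_REq holds_RLess 5 not_less leq_iff)
qed (auto simp: holds_enc holds_RFalse holds_RApply2 holds_value_rel holds_REq holds_RLess
    not_less leq_iff)

lemma holds_neg_rel: "Pi1 p \<Longrightarrow> holds (neg_rel p) (enc xs) \<longleftrightarrow> \<not> sat (look xs) p"
  by (induction arbitrary: xs rule: Pi1.induct) (simp_all add: holds_pos_neg_rel holds_REx)

end

section \<open>The optimal formula\<close>

definition BAll :: "tm \<Rightarrow> fm \<Rightarrow> fm" where
  "BAll t p = All (Imp (Less (Var 0) (lift_tm t)) p)"

definition BEx :: "tm \<Rightarrow> fm \<Rightarrow> fm" where "BEx t p = Neg (BAll t (Neg p))"

definition pair_tm :: "tm \<Rightarrow> tm \<Rightarrow> tm" where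
  "pair_tm s t = Plus (Times (Plus s t) (Plus s t)) s"

text \<open>The bound \<open>Succ c\<close> on the quotient is harmless: the modulus is nonzero, so
  the quotient is at most \<open>c\<close>.\<close>

definition member_fm :: "tm \<Rightarrow> tm \<Rightarrow> tm \<Rightarrow> tm \<Rightarrow> fm" where
  "member_fm c d n t = And (Less t n)
    (BEx (Succ c) (Eq (Times (Var 0) (Succ (Times (Succ (lift_tm t)) (lift_tm d)))) (lift_tm c)))"

abbreviation env3_tm :: "tm \<Rightarrow> tm \<Rightarrow> tm \<Rightarrow> tm \<Rightarrow> tm" where
  "env3_tm x y w a \<equiv> pair_tm x (pair_tm y (pair_tm w a))"

abbreviation node_tm :: "tm \<Rightarrow> tm \<Rightarrow> tm \<Rightarrow> tm" where
  "node_tm k p q \<equiv> pair_tm k (pair_tm p q)"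

text \<open>
  The variables 0 to 9 are \<open>a, w, y, x, q, p, k, n, d, c\<close>; below the quantifier of \<open>u\<close>,
  which becomes variable 0, the indices are raised by 1.
\<close>

definition justified_fm :: fm where
  "justified_fm =
    (let mem = member_fm (Var 9) (Var 8) (Var 7); mem' = member_fm (Var 10) (Var 9) (Var 8);
         e = env3_tm (Var 3) (Var 2) (Var 1) (Var 0); e' = env3_tm (Var 4) (Var 3) (Var 2) (Var 1);
         tag = (\<lambda>i. Eq (Var 6) (numeral_tm i))
     in And (Imp (tag 0) (And (mem (pair_tm (Var 5) e)) (mem (pair_tm (Var 4) e))))
       (And (Imp (tag 1) (Or (mem (pair_tm (Var 5) e)) (mem (pair_tm (Var 4) e))))
       (And (Imp (tag 2) (BEx (Var 7) (mem' (pair_tm (Var 6) (pair_tm (Var 0) e')))))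
       (And (Imp (tag 3)
          (BAll (Var 3) (mem' (pair_tm (Var 6) (env3_tm (Var 0) (Var 3) (Var 2) (Var 1))))))
       (And (Imp (tag 4) (mem (pair_tm (Var 5) (pair_tm (Var 3) (pair_tm (Var 1) (Var 0))))))
       (And (Imp (tag 5) (mem (pair_tm (Var 5) (pair_tm (Var 2) (pair_tm (Var 1) (Var 0))))))
       (And (Imp (tag 6) (Eq (Var 3) Zero))
       (And (Imp (tag 7) (Eq (Var 2) (Succ (Var 3))))
       (And (Imp (tag 8) (Eq (Var 1) (Plus (Var 3) (Var 2))))
       (And (Imp (tag 9) (Eq (Var 1) (Times (Var 3) (Var 2))))
       (Imp (tag 10) (BAll (Var 4) (And
          (Imp (Eq (Var 5) (Succ (Plus (Var 0) (Var 0))))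
            (mem' (pair_tm (Var 6) (pair_tm (Var 0) e'))))
          (Imp (Eq (Var 5) (Succ (Succ (Plus (Var 0) (Var 0)))))
            (mem' (pair_tm (node_tm (Var 7) (Succ (Var 6)) (Var 0)) e'))))))))))))))))"

text \<open>A fact below n has all its components below n, so n bounds every quantifier; its index
  rises by one under each.\<close>

definition certificate_fm :: fm where
  "certificate_fm =
    BAll (Var 0) (BAll (Var 1) (BAll (Var 2) (BAll (Var 3) (BAll (Var 4) (BAll (Var 5) (BAll (Var 6)
      (Imp (member_fm (Var 9) (Var 8) (Var 7)
          (pair_tm (node_tm (Var 6) (Var 5) (Var 4)) (env3_tm (Var 3) (Var 2) (Var 1) (Var 0))))
        justified_fm)))))))"

text \<open>\<open>Var 3\<close> is the argument, under the quantifiers of c, d and n; the fact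
  denied is the start of the decoder, with counter and environment zero.\<close>

definition optimal_fm :: fm where
  "optimal_fm = All (All (All (Neg (And certificate_fm
    (member_fm (Var 2) (Var 1) (Var 0)
      (pair_tm (node_tm (numeral_tm 10) Zero (Var 3)) Zero))))))"

section \<open>Syntactic shape of the optimal formula\<close>

lemma Delta0_BAll: "Delta0 p \<Longrightarrow> Delta0 (BAll t p)"
  unfolding BAll_def by (rule Delta0.intros)

lemma Delta0_BEx: "Delta0 p \<Longrightarrow> Delta0 (BEx t p)"
  unfolding BEx_def by (intro Delta0_BAll Delta0.intros)

lemma Delta0_member_fm: "Delta0 (member_fm c d n t)"
  unfolding member_fm_def by (intro Delta0_BEx Delta0.intros)

lemma Delta0_certificate_fm: "Delta0 certificate_fm"
  unfolding certificate_fm_def justified_fm_def Let_def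
  by (intro Delta0_member_fm Delta0_BAll Delta0_BEx Delta0.intros(1-4))

lemma Pi1_optimal_fm: "Pi1 optimal_fm"
  unfolding optimal_fm_def
  by (intro Pi1.intros(2)) (intro Pi1.intros(1) Delta0.intros(1-4) Delta0_certificate_fm Delta0_member_fm)

lemma fv_lift_tm: "fv_tm (lift_tm t) = Suc ` fv_tm t"
  by (induction t) auto

lemma fv_numeral_tm [simp]: "fv_tm (numeral_tm n) = {}"
  by (induction n) auto

lemma fv_BAll: "fv (BAll t p) = fv_tm t \<union> {n. Suc n \<in> fv p}"
  by (auto simp: BAll_def fv_lift_tm)

lemma fv_BEx: "fv (BEx t p) = fv_tm t \<union> {n. Suc n \<in> fv p}"
  by (simp add: BEx_def fv_BAll)

lemma fv_pair_tm: "fv_tm (pair_tm s t) = fv_tm s \<union> fv_tm t"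
  by (auto simp: pair_tm_def)

lemma fv_member_fm: "fv (member_fm c d n t) = fv_tm c \<union> fv_tm d \<union> fv_tm n \<union> fv_tm t"
  by (auto simp: member_fm_def fv_BEx fv_lift_tm)

lemma fv_justified_fm: "fv justified_fm \<subseteq> {..<10}"
  by (auto simp: justified_fm_def Let_def fv_BAll fv_BEx fv_pair_tm fv_member_fm)

lemma fv_BAll_subset: "fv_tm t \<subseteq> {..<k} \<Longrightarrow> fv p \<subseteq> {..<Suc k} \<Longrightarrow> fv (BAll t p) \<subseteq> {..<k}"
  by (auto simp: fv_BAll)

lemma fv_certificate_fm: "fv certificate_fm \<subseteq> {..<3}"
  unfolding certificate_fm_def
  by (intro fv_BAll_subset) (use fv_justified_fm in \<open>auto simp: fv_member_fm fv_pair_tm\<close>)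

lemma fv_optimal_fm: "fv optimal_fm = {0}"
proof
  have "Suc (Suc (Suc n)) \<notin> fv certificate_fm" for n
    using fv_certificate_fm by auto
  then show "fv optimal_fm \<subseteq> {0}"
    by (auto simp: optimal_fm_def fv_member_fm fv_pair_tm)
  show "{0} \<subseteq> fv optimal_fm"
    by (auto simp: optimal_fm_def fv_member_fm fv_pair_tm numeral_3_eq_3)
qed

section \<open>Meaning of the optimal formula in a model\<close>

context PA_model
begin

lemma sat_BAll: "sat e (BAll t p) \<longleftrightarrow> (\<forall>x. x \<prec> eval e t \<longrightarrow> sat (case_nat x e) p)"
  by (simp add: BAll_def eval_subst)

lemma sat_BEx: "sat e (BEx t p) \<longleftrightarrow> (\<exists>x. x \<prec> eval e t \<and> sat (case_nat x e) p)"
  by (simp add: BEx_def sat_BAll)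

lemma eval_pair_tm: "eval e (pair_tm s t) = pair (eval e s) (eval e t)"
  by (simp add: pair_tm_def pair_def)

lemma sat_member_fm:
  "sat e (member_fm c d n t) \<longleftrightarrow> eval e t \<in> fin_set (eval e c) (eval e d) (eval e n)"
proof -
  have "(\<exists>z. z \<prec> succ x \<and> z \<otimes> beta y i = x) \<longleftrightarrow> (\<exists>z. z \<otimes> beta y i = x)" for x y i
    using leq_times(1)[of "beta y i"] by (auto simp: beta_def less_succ_iff leq_iff simp del: times_succ_right)
  then show ?thesis
    by (simp add: member_fm_def sat_BEx fin_set_def divides_def beta_def eval_subst del: times_succ_right)
qed

lemma pair_lessD: "pair x y \<prec> n \<Longrightarrow> x \<prec> n" "pair x y \<prec> n \<Longrightarrow> y \<prec> n"
  using order.le_less_trans leq_pair by blast+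

lemma less_succ_double: "u \<prec> succ (u \<oplus> u)" "u \<prec> succ (succ (u \<oplus> u))"
proof -
  show "u \<prec> succ (u \<oplus> u)" using leq_plus(1)[of u u] by (simp add: less_succ_iff leq_iff)
  then show "u \<prec> succ (succ (u \<oplus> u))" by (simp add: less_succ_iff)
qed

text \<open>The bounds in the formula lose nothing: a witness occurring in a fact is below n by
  \<open>pair_lessD\<close>, and the remainder \<open>u\<close> of a decoding step is below
  \<open>q\<close>.\<close>

lemma sat_justified_fm:
  assumes "e 9 = c" "e 8 = d" "e 7 = n" "e 6 = k" "e 5 = p" "e 4 = q" "e 3 = x" "e 2 = y"
    "e (Suc 0) = w" "e 0 = a"
  shows "sat e justified_fm \<longleftrightarrow> justified (fin_set c d n) k p q x y w a"
proof -
  have "(\<exists>u. u \<prec> n \<and> pair p (pair u (env3 x y w a)) \<in> fin_set c d n) \<longleftrightarrow>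
      (\<exists>u. pair p (pair u (env3 x y w a)) \<in> fin_set c d n)"
    unfolding fin_set_def by (blast dest: pair_lessD)
  moreover have "(\<forall>u. u \<prec> q \<longrightarrow>
      (q = succ (u \<oplus> u) \<longrightarrow> pair p (pair u (env3 x y w a)) \<in> fin_set c d n) \<and>
      (q = succ (succ (u \<oplus> u)) \<longrightarrow> pair (node k' (succ p) u) (env3 x y w a) \<in> fin_set c d n)) \<longleftrightarrow>
    (\<forall>u. (q = succ (u \<oplus> u) \<longrightarrow> pair p (pair u (env3 x y w a)) \<in> fin_set c d n) \<and>
      (q = succ (succ (u \<oplus> u)) \<longrightarrow> pair (node k' (succ p) u) (env3 x y w a) \<in> fin_set c d n))"
    for k'
    using less_succ_double by blast
  ultimately show ?thesis
    unfolding justified_def justified_fm_def Let_def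
    by (simp add: assms sat_BAll sat_BEx eval_pair_tm sat_member_fm num.simps)
qed

lemma sat_certificate_fm:
  "sat (case_nat n (case_nat d (case_nat c e))) certificate_fm \<longleftrightarrow> certificate (fin_set c d n)"
proof -
  have "sat (case_nat n (case_nat d (case_nat c e))) certificate_fm \<longleftrightarrow>
    (\<forall>k. k \<prec> n \<longrightarrow> (\<forall>p. p \<prec> n \<longrightarrow> (\<forall>q. q \<prec> n \<longrightarrow> (\<forall>x. x \<prec> n \<longrightarrow> (\<forall>y. y \<prec> n \<longrightarrow>
      (\<forall>w. w \<prec> n \<longrightarrow> (\<forall>a. a \<prec> n \<longrightarrow> pair (node k p q) (env3 x y w a) \<in> fin_set c d n \<longrightarrow>
        justified (fin_set c d n) k p q x y w a)))))))"
    unfolding certificate_fm_def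
    by (simp add: sat_BAll sat_member_fm eval_pair_tm sat_justified_fm)
  also have "\<dots> \<longleftrightarrow> certificate (fin_set c d n)"
  proof -
    have "k \<prec> n \<and> p \<prec> n \<and> q \<prec> n \<and> x \<prec> n \<and> y \<prec> n \<and> w \<prec> n \<and> a \<prec> n"
      if "pair (node k p q) (env3 x y w a) \<in> fin_set c d n" for k p q x y w a
    proof -
      have less: "pair (node k p q) (env3 x y w a) \<prec> n" using that by (simp add: fin_set_def)
      show ?thesis
        using pair_lessD[OF pair_lessD(1)[OF less]] pair_lessD[OF pair_lessD(2)[OF less]]
        by (blast dest: pair_lessD)
    qed
    then show ?thesis unfolding certificate_def by blast
  qed
  finally show ?thesis .
qed

lemma sat_optimal_fm:
  "sat e optimal_fm \<longleftrightarrow> \<not> (\<exists>c d n. certificate (fin_set c d n) \<and> decoder_fact \<zero> (e 0) \<in> fin_set c d n)"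
  unfolding optimal_fm_def
  by (simp add: sat_certificate_fm sat_member_fm eval_pair_tm numeral_3_eq_3)

text \<open>The program is the code of \<open>neg_rel p\<close>, since certificates witness falsity
  and \<open>optimal_fm\<close> denies that one exists.\<close>

lemma sat_optimal_prefix_code:
  assumes "Pi1 p" "fv p \<subseteq> {0}"
  shows "sat e (inst optimal_fm (numeral_tm (prefix_code x (rel_code (neg_rel p)))))
    \<longleftrightarrow> sat e (inst p (numeral_tm x))"
proof -
  have "sat e (inst optimal_fm (numeral_tm (prefix_code x (rel_code (neg_rel p)))))
      \<longleftrightarrow> \<not> holds (neg_rel p) (enc [num x])"
    by (simp add: sat_subst sat_optimal_fm certificate_iff_holds enc.simps)
  also have "\<dots> \<longleftrightarrow> sat (look [num x]) p" by (simp add: holds_neg_rel assms(1))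
  also have "\<dots> \<longleftrightarrow> sat e (inst p (numeral_tm x))"
  proof -
    \<comment> \<open>Only variable 0 can occur in \<open>p\<close>, so sending the others to
      \<open>Zero\<close> changes nothing and matches the zero padding of
      \<open>look\<close>.\<close>
    have "inst p (numeral_tm x) = subst (case_nat (numeral_tm x) (\<lambda>_. Zero)) p"
      using assms(2) by (intro subst_cong) (auto split: nat.split)
    moreover have "(\<lambda>n. eval e (case_nat (numeral_tm x) (\<lambda>_. Zero) n)) = look [num x]"
      by (auto simp: fun_eq_iff split: nat.split)
    ultimately show ?thesis by (simp add: sat_subst)
  qed
  finally show ?thesis .
qed

end

text \<open>The same simulation gives universality and optimality. As \<open>fv p\<close> may be
  empty, a closed statement can serve as its own program.\<close>

lemma PA_Iff_optimal_fm:
  assumes "Pi1 p" "fv p \<subseteq> {0}" "PA \<turnstile> Iff T (at_string p s)"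
  shows "PA \<turnstile> Iff T (at_string optimal_fm (s @ False # replicate (rel_code (neg_rel p)) True))"
proof (rule PA_completeness)
  fix z :: nat and succ plus times less e
  assume "PA_model z succ plus times less"
  then interpret PA_model z succ plus times less .
  show "sat e (Iff T (at_string optimal_fm (s @ False # replicate (rel_code (neg_rel p)) True)))"
    using sat_theorem[OF assms(3), of e] sat_optimal_prefix_code[OF assms(1,2), of e "string_nat s"]
    by (simp only: string_nat_prefix_code sat.simps)
qed

lemma universal_optimal_fm: "universal optimal_fm"
  unfolding universal_def
proof (intro conjI allI impI)
  fix T assume T: "Pi1_sentence T"
  then have "inst T t = T" for t
    using subst_cong[of T "case_nat t Var" Var] by (simp add: Pi1_sentence_def)
  moreover have "PA \<turnstile> Iff T T"
    by (rule PA_completeness) (simp add: arith_structure.sat.simps)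
  ultimately have "PA \<turnstile> Iff T (at_string T [])" by simp
  with T show "\<exists>t. PA \<turnstile> Iff T (at_string optimal_fm t)"
    using PA_Iff_optimal_fm[of T T] by (auto simp: Pi1_sentence_def)
qed (simp_all add: Pi1_optimal_fm fv_optimal_fm)

theorem theorem5:
  "\<exists>U. universal U \<and>
     (\<forall>U'. universal U' \<longrightarrow>
       (\<exists>c::nat. \<forall>T. Pi1_sentence T \<longrightarrow> complexity U T \<le> complexity U' T + c))"
proof (intro exI conjI allI impI)
  show "universal optimal_fm" by (rule universal_optimal_fm)
  fix U' T
  assume U': "universal U'" and T: "Pi1_sentence T"
  \<comment> \<open>Universality of \<open>U'\<close> provides some string, so that the minimal
    length is attained.\<close>
  then have "\<exists>n t. length t = n \<and> PA \<turnstile> Iff T (at_string U' t)" by (auto simp: universal_def)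
  then have "\<exists>t. length t = complexity U' T \<and> PA \<turnstile> Iff T (at_string U' t)"
    unfolding complexity_def by (rule LeastI_ex)
  then obtain t where t: "length t = complexity U' T" "PA \<turnstile> Iff T (at_string U' t)" by blast
  let ?k = "rel_code (neg_rel U')"
  have "PA \<turnstile> Iff T (at_string optimal_fm (t @ False # replicate ?k True))"
    using U' t(2) by (intro PA_Iff_optimal_fm) (auto simp: universal_def)
  then have "complexity optimal_fm T \<le> length (t @ False # replicate ?k True)"
    unfolding complexity_def by (intro Least_le) blast
  \<comment> \<open>The constant counts the separator and the \<open>?k\<close> symbols of the
    program, so it depends on \<open>U'\<close> only.\<close>
  then show "complexity optimal_fm T \<le> complexity U' T + Suc ?k" by (simp add: t(1))
qed

end
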